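(* Let $d\ge1$ and $\mu\in(-1,1)$, and let $\mathbf A_\mu$ be the universal unital $C^*$-algebra generated by elements $a_i,a_i^*$, $i=1,\dots,d$, subject to the twisted canonical commutation relations $$a_i^*a_i=1+\mu^2a_ia_i^*-(1-\mu^2)\sum_{k<i}a_ka_k^*,\quad i=1,\dots,d,$$ $$a_i^*a_j=\mu a_ja_i^*,\ i\neq j,\qquad a_ja_i=\mu a_ia_j,\ i<j.$$ Then the Fock representation of $\mathbf A_\mu$ is faithful.
   Context: The Fock representation of $\mathbf A_\mu$ is the irreducible representation $\pi_F$ on a Hilbert space determined (up to unitary equivalence) by a cyclic unit vector $\Omega$ such that $\pi_F(a_i^* )\Omega=0$ for $i=1,\dots,d$. The universal $C^*$-algebra of a unital $*$-algebra $\mathcal A$ given by generators and relations is a $C^*$-algebra $\mathbf A$ with a $*$-homomorphism $\psi\colon\mathcal A\to\mathbf A$ such that for every $*$-homomorphism $\varphi\colon\mathcal A\to B$ into a $C^*$-algebra $B$ there is a $*$-homomorphism $\theta\colon\mathbf A\to B$ with $\theta\psi=\varphi$; it is the completion of $\mathcal A$, modulo the kernel, in the seminorm $\sup_\pi\|\pi(\cdot)\|$ over all bounded representations $\pi$. For the relations above the supremum is finite, since $\|\pi(a_ia_i^* )\|\le\frac1{1-\mu^2}$ for every bounded representation $\pi$. *)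

theory Defs
  imports "HOL-Analysis.Analysis" "HOL-Algebra.Algebraic_Closure_Type"
begin

section \<open>Complex Hilbert spaces\<close>

text \<open>The inner product is linear in its first argument. Positive definiteness follows from
  the last axiom, because \<open>norm\<close> is a norm; completeness is part of \<^class>\<open>banach\<close>.\<close>

class complex_hilbert_space = banach +
  fixes scaleC :: "complex \<Rightarrow> 'a \<Rightarrow> 'a" (infixr \<open>*\<^sub>C\<close> 75)
    and cinner :: "'a \<Rightarrow> 'a \<Rightarrow> complex"
  assumes scaleC_add_right: "c *\<^sub>C (x + y) = c *\<^sub>C x + c *\<^sub>C y"
    and scaleC_add_left: "(b + c) *\<^sub>C x = b *\<^sub>C x + c *\<^sub>C x"
    and scaleC_scaleC: "b *\<^sub>C c *\<^sub>C x = (b * c) *\<^sub>C x"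
    and scaleC_of_real: "complex_of_real r *\<^sub>C x = scaleR r x"
    and cinner_commute: "cinner x y = cnj (cinner y x)"
    and cinner_add_left: "cinner (x + y) z = cinner x z + cinner y z"
    and cinner_scaleC_left: "cinner (c *\<^sub>C x) y = c * cinner x y"
    and norm_eq_sqrt_cinner: "norm x = sqrt (Re (cinner x x))"

instantiation complex :: complex_hilbert_space
begin

definition scaleC_complex :: "complex \<Rightarrow> complex \<Rightarrow> complex"
  where "scaleC_complex c x = c * x"

definition cinner_complex :: "complex \<Rightarrow> complex \<Rightarrow> complex"
  where "cinner_complex x y = x * cnj y"

instance
  by standard
    (auto simp: scaleC_complex_def cinner_complex_def algebra_simps scaleR_conv_of_real
      cmod_def power2_eq_square)

end

definition bounded_clinear :: "('h \<Rightarrow> 'h :: complex_hilbert_space) \<Rightarrow> bool"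
  where "bounded_clinear T \<longleftrightarrow> bounded_linear T \<and> (\<forall>c x. T (c *\<^sub>C x) = c *\<^sub>C T x)"

definition csubspace :: "'h :: complex_hilbert_space set \<Rightarrow> bool"
  where "csubspace V \<longleftrightarrow>
    0 \<in> V \<and> (\<forall>x\<in>V. \<forall>y\<in>V. x + y \<in> V) \<and> (\<forall>c. \<forall>x\<in>V. c *\<^sub>C x \<in> V)"

section \<open>Unital C*-algebras\<close>

record 'a star_algebra = "(complex, 'a) module" +
  star :: "'a \<Rightarrow> 'a"
  cnorm :: "'a \<Rightarrow> real"

text \<open>\<^locale>\<open>Metric_space\<close> requires symmetry and non-negativity of the distance on the whole type,
  hence the value 0 outside the carrier.\<close>

definition norm_dist :: "('a, 'm) star_algebra_scheme \<Rightarrow> 'a \<Rightarrow> 'a \<Rightarrow> real"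
  where "norm_dist A x y =
    (if x \<in> carrier A \<and> y \<in> carrier A then cnorm A (x \<ominus>\<^bsub>A\<^esub> y) else 0)"

locale cstar_algebra =
  ring A + scalar: module "ring_of_type_algebra :: complex ring" A
  for A :: "('a, 'm) star_algebra_scheme" (structure) +
  assumes smult_mult_left:
      "\<lbrakk>x \<in> carrier A; y \<in> carrier A\<rbrakk> \<Longrightarrow> (c \<odot> x) \<otimes> y = c \<odot> (x \<otimes> y)"
    and smult_mult_right:
      "\<lbrakk>x \<in> carrier A; y \<in> carrier A\<rbrakk> \<Longrightarrow> x \<otimes> (c \<odot> y) = c \<odot> (x \<otimes> y)"
    and star_closed: "x \<in> carrier A \<Longrightarrow> star A x \<in> carrier A"
    and star_star: "x \<in> carrier A \<Longrightarrow> star A (star A x) = x"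
    and star_add:
      "\<lbrakk>x \<in> carrier A; y \<in> carrier A\<rbrakk> \<Longrightarrow> star A (x \<oplus> y) = star A x \<oplus> star A y"
    and star_mult:
      "\<lbrakk>x \<in> carrier A; y \<in> carrier A\<rbrakk> \<Longrightarrow> star A (x \<otimes> y) = star A y \<otimes> star A x"
    and star_smult: "x \<in> carrier A \<Longrightarrow> star A (c \<odot> x) = cnj c \<odot> star A x"
    and cnorm_eq_0_iff: "x \<in> carrier A \<Longrightarrow> cnorm A x = 0 \<longleftrightarrow> x = \<zero>"
    and cnorm_add:
      "\<lbrakk>x \<in> carrier A; y \<in> carrier A\<rbrakk> \<Longrightarrow> cnorm A (x \<oplus> y) \<le> cnorm A x + cnorm A y"
    and cnorm_smult: "x \<in> carrier A \<Longrightarrow> cnorm A (c \<odot> x) = cmod c * cnorm A x"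
    and cnorm_mult:
      "\<lbrakk>x \<in> carrier A; y \<in> carrier A\<rbrakk> \<Longrightarrow> cnorm A (x \<otimes> y) \<le> cnorm A x * cnorm A y"
    and cstar_identity: "x \<in> carrier A \<Longrightarrow> cnorm A (star A x \<otimes> x) = (cnorm A x)\<^sup>2"
    and complete: "Metric_space.mcomplete (carrier A) (norm_dist A)"
begin

lemma smult_minus_one:
  assumes "x \<in> carrier A"
  shows "(- 1 :: complex) \<odot> x = \<ominus> x"
proof -
  have sc: "c \<odot> x \<in> carrier A" for c
    using scalar.smult_closed[of c x] assms by (simp add: ring_of_type_algebra_def)
  have one: "(1 :: complex) \<odot> x = x"
    using scalar.smult_one[of x] assms by (simp add: ring_of_type_algebra_def)
  have add: "(b + c) \<odot> x = b \<odot> x \<oplus> c \<odot> x" for b c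
    using scalar.smult_l_distr[of b c x] assms by (simp add: ring_of_type_algebra_def)
  have "(0 :: complex) \<odot> x = \<zero>"
    using add[of 0 0] sc[of 0] by (simp add: add.l_cancel_one')
  hence "(- 1 :: complex) \<odot> x \<oplus> x = \<zero>"
    using add[of "- 1" 1] one by simp
  thus ?thesis
    using assms sc minus_equality by metis
qed

lemma Metric_space_norm_dist: "Metric_space (carrier A) (norm_dist A)"
proof -
  have uminus: "cnorm A (\<ominus> x) = cnorm A x" if "x \<in> carrier A" for x
    using cnorm_smult[OF that, of "- 1"] smult_minus_one[OF that] by simp
  have nonneg: "0 \<le> cnorm A x" if "x \<in> carrier A" for x
  proof -
    have "cnorm A (x \<oplus> \<ominus> x) \<le> cnorm A x + cnorm A (\<ominus> x)"
      using that by (intro cnorm_add) auto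
    thus ?thesis
      using that uminus cnorm_eq_0_iff[of \<zero>] by (simp add: r_neg)
  qed
  show ?thesis
  proof
    show "0 \<le> norm_dist A x y" for x y
      by (simp add: norm_dist_def nonneg)
    have "cnorm A (x \<ominus> y) = cnorm A (y \<ominus> x)" if "x \<in> carrier A" "y \<in> carrier A" for x y
    proof -
      have "\<ominus> (x \<ominus> y) = y \<ominus> x"
        using that by (simp add: minus_eq minus_add minus_minus a_comm)
      thus ?thesis
        using uminus[of "x \<ominus> y"] that by simp
    qed
    thus "norm_dist A x y = norm_dist A y x" for x y
      by (simp add: norm_dist_def)
    show "norm_dist A x y = 0 \<longleftrightarrow> x = y" if "x \<in> carrier A" "y \<in> carrier A" for x y
      using that by (simp add: norm_dist_def cnorm_eq_0_iff)
    show "norm_dist A x z \<le> norm_dist A x y + norm_dist A y z"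
      if "x \<in> carrier A" "y \<in> carrier A" "z \<in> carrier A" for x y z
    proof -
      have "x \<ominus> z = (x \<ominus> y) \<oplus> (y \<ominus> z)"
        using that by (simp add: minus_eq a_assoc) (simp add: a_assoc[symmetric] l_neg)
      thus ?thesis
        using that cnorm_add[of "x \<ominus> y" "y \<ominus> z"] by (simp add: norm_dist_def)
    qed
  qed
qed

end

definition closed_star_subalgebra :: "'a star_algebra \<Rightarrow> 'a set \<Rightarrow> bool"
  where "closed_star_subalgebra A S \<longleftrightarrow>
    subring S A \<and> (\<forall>c. \<forall>x\<in>S. c \<odot>\<^bsub>A\<^esub> x \<in> S) \<and> (\<forall>x\<in>S. star A x \<in> S) \<and>
    closedin (Metric_space.mtopology (carrier A) (norm_dist A)) S"

definition cstar_generated_by :: "'a star_algebra \<Rightarrow> 'a set \<Rightarrow> bool"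
  where "cstar_generated_by A G \<longleftrightarrow>
    G \<subseteq> carrier A \<and> (\<forall>S. closed_star_subalgebra A S \<and> G \<subseteq> S \<longrightarrow> S = carrier A)"

text \<open>\<^const>\<open>ring_hom\<close> includes preservation of the unit.\<close>

definition star_hom :: "'a star_algebra \<Rightarrow> 'b star_algebra \<Rightarrow> ('a \<Rightarrow> 'b) set"
  where "star_hom A B = {\<theta> \<in> ring_hom A B.
    (\<forall>c. \<forall>x\<in>carrier A. \<theta> (c \<odot>\<^bsub>A\<^esub> x) = c \<odot>\<^bsub>B\<^esub> \<theta> x) \<and>
    (\<forall>x\<in>carrier A. \<theta> (star A x) = star B (\<theta> x))}"

section \<open>The twisted canonical commutation relations\<close>

definition twisted_ccr :: "nat \<Rightarrow> real \<Rightarrow> 'a star_algebra \<Rightarrow> (nat \<Rightarrow> 'a) \<Rightarrow> bool"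
  where "twisted_ccr d \<mu> A a \<longleftrightarrow>
    (\<forall>i\<in>{1..d}. a i \<in> carrier A) \<and>
    (\<forall>i\<in>{1..d}. star A (a i) \<otimes>\<^bsub>A\<^esub> a i =
      \<one>\<^bsub>A\<^esub> \<oplus>\<^bsub>A\<^esub> complex_of_real (\<mu>\<^sup>2) \<odot>\<^bsub>A\<^esub> (a i \<otimes>\<^bsub>A\<^esub> star A (a i))
        \<ominus>\<^bsub>A\<^esub> complex_of_real (1 - \<mu>\<^sup>2) \<odot>\<^bsub>A\<^esub> (\<Oplus>\<^bsub>A\<^esub>k\<in>{1..<i}. a k \<otimes>\<^bsub>A\<^esub> star A (a k))) \<and>
    (\<forall>i\<in>{1..d}. \<forall>j\<in>{1..d}. i \<noteq> j \<longrightarrow>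
      star A (a i) \<otimes>\<^bsub>A\<^esub> a j = complex_of_real \<mu> \<odot>\<^bsub>A\<^esub> (a j \<otimes>\<^bsub>A\<^esub> star A (a i))) \<and>
    (\<forall>i\<in>{1..d}. \<forall>j\<in>{1..d}. i < j \<longrightarrow>
      a j \<otimes>\<^bsub>A\<^esub> a i = complex_of_real \<mu> \<odot>\<^bsub>A\<^esub> (a i \<otimes>\<^bsub>A\<^esub> a j))"

text \<open>A *-homomorphism from the *-algebra presented by the relations into \<open>B\<close> is the same as a
  family \<open>b\<close> in \<open>B\<close> satisfying them, so the universal property is expressed through such families.

  The target algebras \<open>B\<close> range over all C*-algebras carried by subsets of the type of \<open>A\<close>, since
  HOL cannot quantify over types inside a formula. An algebra with the universal property for
  targets of every type satisfies this predicate in particular, so nothing is lost in assuming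
  it. Conversely, if \<open>A\<close> is non-zero, then its type has at least the cardinality of the
  continuum, while a C*-algebra generated by finitely many elements is separable and hence has at
  most that cardinality; so for non-zero \<open>A\<close> the property for arbitrary targets follows.\<close>

definition universal_twisted_ccr_algebra ::
    "nat \<Rightarrow> real \<Rightarrow> 'a star_algebra \<Rightarrow> (nat \<Rightarrow> 'a) \<Rightarrow> bool"
  where "universal_twisted_ccr_algebra d \<mu> A a \<longleftrightarrow>
    cstar_algebra A \<and> twisted_ccr d \<mu> A a \<and> cstar_generated_by A (a ` {1..d}) \<and>
    (\<forall>(B :: 'a star_algebra) b. cstar_algebra B \<and> twisted_ccr d \<mu> B b \<longrightarrow>
      (\<exists>\<theta>\<in>star_hom A B. \<forall>i\<in>{1..d}. \<theta> (a i) = b i))"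

section \<open>Representations\<close>

definition representation ::
    "'a star_algebra \<Rightarrow> ('a \<Rightarrow> 'h \<Rightarrow> 'h :: complex_hilbert_space) \<Rightarrow> bool"
  where "representation A \<pi> \<longleftrightarrow>
    (\<forall>x\<in>carrier A. bounded_clinear (\<pi> x)) \<and>
    (\<forall>x\<in>carrier A. \<forall>y\<in>carrier A. \<pi> (x \<oplus>\<^bsub>A\<^esub> y) = (\<lambda>v. \<pi> x v + \<pi> y v)) \<and>
    (\<forall>x\<in>carrier A. \<forall>y\<in>carrier A. \<pi> (x \<otimes>\<^bsub>A\<^esub> y) = \<pi> x \<circ> \<pi> y) \<and>
    (\<forall>c. \<forall>x\<in>carrier A. \<pi> (c \<odot>\<^bsub>A\<^esub> x) = (\<lambda>v. c *\<^sub>C \<pi> x v)) \<and>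
    \<pi> \<one>\<^bsub>A\<^esub> = id \<and>
    (\<forall>x\<in>carrier A. \<forall>u v. cinner (\<pi> x u) v = cinner u (\<pi> (star A x) v))"

definition irreducible_representation ::
    "'a star_algebra \<Rightarrow> ('a \<Rightarrow> 'h \<Rightarrow> 'h :: complex_hilbert_space) \<Rightarrow> bool"
  where "irreducible_representation A \<pi> \<longleftrightarrow>
    representation A \<pi> \<and> (\<exists>v :: 'h. v \<noteq> 0) \<and>
    (\<forall>V. csubspace V \<and> closed V \<and> (\<forall>x\<in>carrier A. \<pi> x ` V \<subseteq> V) \<longrightarrow> V = {0} \<or> V = UNIV)"

definition cyclic_vector ::
    "'a star_algebra \<Rightarrow> ('a \<Rightarrow> 'h \<Rightarrow> 'h :: complex_hilbert_space) \<Rightarrow> 'h \<Rightarrow> bool"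
  where "cyclic_vector A \<pi> \<Omega> \<longleftrightarrow> closure ((\<lambda>x. \<pi> x \<Omega>) ` carrier A) = UNIV"

definition fock_representation ::
    "nat \<Rightarrow> 'a star_algebra \<Rightarrow> (nat \<Rightarrow> 'a) \<Rightarrow>
      ('a \<Rightarrow> 'h \<Rightarrow> 'h :: complex_hilbert_space) \<Rightarrow> 'h \<Rightarrow> bool"
  where "fock_representation d A a \<pi> \<Omega> \<longleftrightarrow>
    irreducible_representation A \<pi> \<and> norm \<Omega> = 1 \<and> cyclic_vector A \<pi> \<Omega> \<and>
    (\<forall>i\<in>{1..d}. \<pi> (star A (a i)) \<Omega> = 0)"

definition faithful :: "'a star_algebra \<Rightarrow> ('a \<Rightarrow> 'h \<Rightarrow> 'h) \<Rightarrow> bool"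
  where "faithful A \<pi> \<longleftrightarrow> inj_on \<pi> (carrier A)"

end

theory Submission
  imports Defs "HOL-Real_Asymp.Real_Asymp"
begin

text \<open>By Wick ordering, every polynomial \<open>y\<close> in the generators and their adjoints is a combination of
  the contractions \<open>b\<^sup>r (b\<^sup>s)\<^sup>*\<close>, where \<open>r\<close>, \<open>s\<close> are multi-indices and \<open>b\<^sub>i\<close> is the generator \<open>a\<^sub>i\<close> scaled
  by the square root of \<open>1 - \<mu>\<^sup>2\<close>. Each coefficient is recovered from the matrix elements of \<open>\<pi> y\<close>
  between vectors \<open>b\<^sup>k \<Omega>\<close> by inverting a \<open>q\<close>-convolution with \<open>q = \<mu>\<^sup>2\<close>, and is therefore bounded by the
  norm of \<open>\<pi> y\<close> times a polynomial in the degree of \<open>y\<close>; the same holds for the norm of \<open>y\<close>. The C*-identity removes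
  the polynomial factor: apply this to the powers \<open>(y\<^sup>* y)\<^sup>N\<close> and take \<open>N\<close>-th roots. So \<open>\<pi>\<close> is isometric
  on polynomials, hence injective.\<close>

section \<open>Complex Hilbert spaces\<close>

text \<open>Roots of order \<open>N\<close> remove a polynomial loss but not an exponential one, and
  this shapes the proof. The relations \<open>a_j a_i = \<mu> a_i a_j\<close> sort every word into
  an ordered monomial up to a scalar, so degree \<open>D\<close> involves at most
  \<open>(D + 1)^(2 d)\<close> Wick monomials, whereas unsorted words may be exponentially many. The
  other ingredient is uniformity: \<open>(q; q)_n\<close> stays above a positive constant as
  \<open>n\<close> grows, so inverting the \<open>q\<close>-convolution costs a fixed factor per
  variable and per term. The obstacle to a one-variable calculus is the sum over
  \<open>k < i\<close> in the first relation. It vanishes on vectors killed by the adjoints of the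
  earlier generators; therefore the test vectors are built from the vacuum starting with the last
  variable, and the formulas for matrix elements are stated on such vectors. The passage from
  polynomials to all of \<open>A\<close> rests on representations being contractive, which is
  derived from the C*-identity and completeness.\<close>

lemma cinner_add_right:
  fixes x y z :: "'h :: complex_hilbert_space"
  shows "cinner x (y + z) = cinner x y + cinner x z"
  by (metis cinner_commute cinner_add_left complex_cnj_add)

lemma cinner_scaleC_right:
  fixes x y :: "'h :: complex_hilbert_space"
  shows "cinner x (c *\<^sub>C y) = cnj c * cinner x y"
  by (metis cinner_commute cinner_scaleC_left complex_cnj_mult)

lemma cinner_zero_left [simp]: "cinner 0 (y :: 'h :: complex_hilbert_space) = 0"
  using cinner_add_left[of 0 0 y] by simp

lemma cinner_zero_right [simp]: "cinner (y :: 'h :: complex_hilbert_space) 0 = 0"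
  using cinner_add_right[of y 0 0] by simp

lemma scaleC_zero_left [simp]: "0 *\<^sub>C (x :: 'h :: complex_hilbert_space) = 0"
  using scaleC_add_left[of 0 0 x] by simp

lemma scaleC_zero_right [simp]: "c *\<^sub>C (0 :: 'h :: complex_hilbert_space) = 0"
  using scaleC_add_right[of c 0 0] by simp

lemma scaleC_one [simp]: "1 *\<^sub>C (x :: 'h :: complex_hilbert_space) = x"
  using scaleC_of_real[of 1 x] by simp

lemma cinner_self: "cinner x x = complex_of_real ((norm (x :: 'h :: complex_hilbert_space))\<^sup>2)"
proof -
  \<comment> \<open>\<open>sqrt\<close> is odd on the reals, so \<open>0 \<le> sqrt t\<close> forces
    \<open>0 \<le> t\<close>: positivity of the inner product is read off from positivity of the
    norm.\<close>
  have "0 \<le> sqrt (Re (cinner x x))"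
    using norm_ge_zero[of x] by (simp only: norm_eq_sqrt_cinner)
  hence "(norm x)\<^sup>2 = Re (cinner x x)"
    by (simp add: norm_eq_sqrt_cinner)
  moreover have "Im (cinner x x) = 0"
    using arg_cong[OF cinner_commute[of x x], of Im] by simp
  ultimately show ?thesis
    by (simp add: complex_eq_iff)
qed

lemma norm_scaleC:
  "norm (c *\<^sub>C (x :: 'h :: complex_hilbert_space)) = cmod c * norm x"
proof -
  have "complex_of_real ((norm (c *\<^sub>C x))\<^sup>2) = complex_of_real ((cmod c * norm x)\<^sup>2)"
    using complex_norm_square[of c] cinner_self[of x]
    by (simp only: cinner_self[symmetric] cinner_scaleC_left cinner_scaleC_right power_mult_distrib
        of_real_mult) (simp add: mult_ac)
  hence "(norm (c *\<^sub>C x))\<^sup>2 = (cmod c * norm x)\<^sup>2"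
    by (simp only: of_real_eq_iff)
  thus ?thesis
    by (simp add: power2_eq_iff_nonneg)
qed

lemma norm_add_sq:
  fixes x y :: "'h :: complex_hilbert_space"
  shows "(norm (x + y))\<^sup>2 = (norm x)\<^sup>2 + 2 * Re (cinner x y) + (norm y)\<^sup>2"
proof -
  have "complex_of_real ((norm (x + y))\<^sup>2) =
      of_real ((norm x)\<^sup>2) + (cinner x y + cnj (cinner x y)) + of_real ((norm y)\<^sup>2)"
    unfolding cinner_self[symmetric] cinner_add_left cinner_add_right
    using cinner_commute[of y x] by simp
  from arg_cong[OF this, of Re] show ?thesis by simp
qed

text \<open>The usual order is reversed: the triangle inequality is already an axiom of the norm,
  and squaring it bounds the real part. The factor \<open>c\<close> then rotates the inner product
  onto the real axis; it is 0 if the inner product is 0, hence only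
  \<open>cmod c \<le> 1\<close>.\<close>

lemma cinner_Cauchy_Schwarz:
  fixes x y :: "'h :: complex_hilbert_space"
  shows "cmod (cinner x y) \<le> norm x * norm y"
proof -
  have re: "Re (cinner x y) \<le> norm x * norm y" for x y :: 'h
  proof -
    have "(norm (x + y))\<^sup>2 \<le> (norm x + norm y)\<^sup>2"
      by (simp add: norm_triangle_ineq power_mono)
    thus ?thesis by (simp add: norm_add_sq power2_sum)
  qed
  define c where "c = cnj (sgn (cinner x y))"
  have "cmod c \<le> 1"
    by (simp add: c_def norm_sgn)
  have "complex_of_real (cmod (cinner x y)) = c * cinner x y"
  proof (cases "cinner x y = 0")
    case False
    hence "c * cinner x y = cinner x y * cnj (cinner x y) / cmod (cinner x y)"
      by (simp add: c_def sgn_div_norm divide_inverse scaleR_conv_of_real mult_ac)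
    thus ?thesis
      using False by (simp add: complex_norm_square[symmetric] power2_eq_square)
  qed simp
  hence "cmod (cinner x y) = Re (cinner (c *\<^sub>C x) y)"
    by (metis Re_complex_of_real cinner_scaleC_left)
  also have "\<dots> \<le> norm (c *\<^sub>C x) * norm y"
    by (rule re)
  also have "\<dots> \<le> 1 * norm x * norm y"
    unfolding norm_scaleC using \<open>cmod c \<le> 1\<close> by (intro mult_right_mono) auto
  finally show ?thesis by simp
qed

section \<open>The finite \<open>q\<close>-Pochhammer symbol\<close>

definition qpoch :: "real \<Rightarrow> nat \<Rightarrow> real"
  where "qpoch q n = (\<Prod>k\<in>{1..n}. 1 - q ^ k)"

lemma qpoch_0 [simp]: "qpoch q 0 = 1"
  by (simp add: qpoch_def)

lemma qpoch_Suc: "qpoch q (Suc n) = qpoch q n * (1 - q ^ Suc n)"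
  by (simp add: qpoch_def)

lemma sum_power_le:
  fixes q :: real
  assumes "0 \<le> q" "q < 1"
  shows "(\<Sum>k<n. q ^ k) \<le> 1 / (1 - q)"
  using assms by (simp add: sum_gp_strict divide_right_mono)

lemma qpoch_pos: "0 \<le> q \<Longrightarrow> q < 1 \<Longrightarrow> 0 < qpoch q n"
  using power_less_one_iff[of q] by (induction n) (auto simp: qpoch_Suc simp del: power_Suc)

text \<open>Uniformity in \<open>n\<close> is the point. Each factor
  \<open>1 / (1 - q^(k+1))\<close> is at most \<open>exp (q^k / (1 - q))\<close>, and the exponents
  form a geometric series.\<close>

lemma inverse_qpoch_le:
  assumes "0 \<le> q" "q < 1"
  shows "1 / qpoch q n \<le> exp (1 / (1 - q)\<^sup>2)"
proof -
  have "1 / qpoch q n \<le> exp ((\<Sum>k<n. q ^ k) / (1 - q))"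
  proof (induction n)
    case (Suc n)
    have q: "q ^ Suc n < 1" "q ^ Suc n \<le> q" "q ^ Suc n \<le> q ^ n"
      using assms power_Suc_less_one[of q n] power_decreasing[of 1 "Suc n" q]
        power_decreasing[of n "Suc n" q]
      by (cases "q = 0"; simp)+
    have "1 / (1 - q ^ Suc n) = 1 + q ^ Suc n / (1 - q ^ Suc n)"
      using q by (simp add: field_simps del: power_Suc)
    also have "\<dots> \<le> 1 + q ^ n / (1 - q)"
      using q assms by (intro add_left_mono frac_le) auto
    also have "\<dots> \<le> exp (q ^ n / (1 - q))"
      by (rule exp_ge_add_one_self)
    finally have "1 / qpoch q n * (1 / (1 - q ^ Suc n)) \<le>
        exp ((\<Sum>k<n. q ^ k) / (1 - q)) * exp (q ^ n / (1 - q))"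
      using Suc q qpoch_pos[OF assms, of n] by (intro mult_mono) auto
    thus ?case
      by (simp add: qpoch_Suc exp_add[symmetric] add_divide_distrib del: power_Suc)
  qed simp
  also have "\<dots> \<le> exp (1 / (1 - q)\<^sup>2)"
    using sum_power_le[OF assms, of n] assms
      divide_right_mono[of "\<Sum>k<n. q ^ k" "1 / (1 - q)" "1 - q"]
    by (simp add: power2_eq_square)
  finally show ?thesis .
qed

text \<open>The exponent is \<open>k (k - 1) / 2\<close>; by Euler's expansion these are the
  coefficients of \<open>(z; q)_\<infinity>\<close>, while those of its reciprocal are
  \<open>1 / (q; q)_n\<close>.\<close>

definition qweight :: "real \<Rightarrow> nat \<Rightarrow> real"
  where "qweight q k = (- 1) ^ k * q ^ (\<Sum>{..<k}) / qpoch q k"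

text \<open>Coefficientwise, \<open>(z; q)\<^sub>\<infinity>\<close> times \<open>1 / (z; q)\<^sub>\<infinity>\<close> is 1.\<close>

lemma qweight_convolution:
  assumes "0 \<le> q" "q < 1"
  shows "(\<Sum>k\<le>N. qweight q k / qpoch q (N - k)) = (if N = 0 then 1 else 0)"
proof (cases N)
  case (Suc M)
  have ne: "qpoch q n \<noteq> 0" "1 - q ^ Suc n \<noteq> 0" for n
    using qpoch_pos[OF assms, of n] assms power_Suc_less_one[of q n] by (cases "q = 0"; simp)+
  \<comment> \<open>The field arithmetic of the induction step below, with
    \<open>u = 1 - q^(j+1)\<close>, \<open>v = 1 - q^(i+1)\<close>, \<open>w = 1 - q^N\<close> and
    \<open>x = q^(j+1)\<close>; the last premise holds because
    \<open>q^N = q^(j+1) q^(i+1)\<close>.\<close>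
  have aux: "a * s / (c * (f * v) * w) + (- 1) * a * s / (c * u * (f * v)) =
      (- 1) * a * s * x / (c * u * f * w)"
    if "c \<noteq> 0" "f \<noteq> 0" "u \<noteq> 0" "v \<noteq> 0" "w \<noteq> 0" "u - w = - x * v" for a s c f u v w x :: real
  proof -
    have "a * s / (c * (f * v) * w) + (- 1) * a * s / (c * u * (f * v)) =
        a * s * (u - w) / (c * f * u * v * w)"
      using that(1-5) by (simp add: field_simps)
    also have "\<dots> = (- 1) * a * s * x / (c * u * f * w)"
      using that by (simp add: mult_ac)
    finally show ?thesis .
  qed
  \<comment> \<open>The partial sums have a closed product form. At \<open>j = M\<close> it is the
    negative of the one remaining term \<open>qweight q N\<close>.\<close>
  have partial: "(\<Sum>k\<le>j. qweight q k / qpoch q (N - k)) =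
      (- 1) ^ j * q ^ (\<Sum>{..<Suc j}) / (qpoch q j * qpoch q (M - j) * (1 - q ^ N))"
    if "j \<le> M" for j
    using that
  proof (induction j)
    case 0
    thus ?case by (simp add: qweight_def Suc qpoch_Suc del: power_Suc)
  next
    case (Suc j)
    obtain i where i: "M = Suc j + i"
      using Suc.prems le_Suc_ex by blast
    have N: "N = Suc (Suc (j + i))"
      using \<open>N = Suc M\<close> i by simp
    have pw: "q ^ N = q ^ Suc j * q ^ Suc i"
      by (simp add: N power_add)
    have n0: "1 - q ^ Suc j * q ^ Suc i \<noteq> 0"
      using ne(2)[of "Suc (j + i)"] by (simp only: N[symmetric] pw not_False_eq_True)
    have "(\<Sum>k\<le>Suc j. qweight q k / qpoch q (N - k)) =
      (- 1) ^ j * q ^ (\<Sum>{..<Suc j}) / (qpoch q j * qpoch q (Suc i) * (1 - q ^ N)) +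
      (- 1) ^ Suc j * q ^ (\<Sum>{..<Suc j}) / (qpoch q (Suc j) * qpoch q (Suc i))"
      using Suc.IH Suc.prems i N by (simp add: qweight_def del: power_Suc)
    also have "\<dots> = (- 1) ^ Suc j * q ^ (\<Sum>{..<Suc j}) * q ^ Suc j /
        (qpoch q (Suc j) * qpoch q i * (1 - q ^ N))"
      unfolding qpoch_Suc pw power_Suc[of "- 1 :: real"]
      by (rule aux[OF ne(1)[of j] ne(1)[of i] ne(2)[of j] ne(2)[of i] n0]) (simp add: algebra_simps)
    also have "\<dots> = (- 1) ^ Suc j * q ^ (\<Sum>{..<Suc (Suc j)}) /
        (qpoch q (Suc j) * qpoch q (M - Suc j) * (1 - q ^ N))"
      by (simp add: i power_add mult_ac)
    finally show ?case .
  qed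
  have "(\<Sum>k\<le>N. qweight q k / qpoch q (N - k)) =
      (- 1) ^ M * q ^ (\<Sum>{..<N}) / (qpoch q M * (1 - q ^ N)) + qweight q N"
    using partial[of M] Suc by simp
  also have "\<dots> = 0"
    using ne(1)[of M] ne(2)[of M]
    by (simp add: Suc qweight_def qpoch_Suc divide_simps del: power_Suc sum.lessThan_Suc) simp
  finally show ?thesis using Suc by simp
qed (simp add: qweight_def)

lemma abs_qweight_le:
  assumes "0 \<le> q" "q < 1"
  shows "\<bar>qweight q k\<bar> \<le> exp (1 / (1 - q)\<^sup>2)"
proof -
  have "\<bar>qweight q k\<bar> = q ^ (\<Sum>{..<k}) * (1 / qpoch q k)"
    using qpoch_pos[OF assms, of k] assms by (simp add: qweight_def abs_mult power_abs)
  also have "\<dots> \<le> 1 * exp (1 / (1 - q)\<^sup>2)"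
    using inverse_qpoch_le[OF assms, of k] qpoch_pos[OF assms, of k] assms
    by (intro mult_mono power_le_one) auto
  finally show ?thesis by simp
qed

section \<open>The vacuum space of the twisted relations\<close>

text \<open>The formula for \<open>bs i (b i x)\<close> is assumed only where all earlier
  \<open>bs j x\<close> vanish: there the terms \<open>b_j b_j^*\<close> with \<open>j < i\<close>
  drop out and the \<open>q\<close>-relation of a single variable remains.\<close>

locale fock_operators =
  fixes d :: nat and \<mu> :: real
    and b bs :: "nat \<Rightarrow> 'h \<Rightarrow> 'h :: complex_hilbert_space" and \<Omega> :: 'h
  assumes \<mu>: "\<bar>\<mu>\<bar> < 1"
    and b_scaleC: "i \<in> {1..d} \<Longrightarrow> b i (c *\<^sub>C x) = c *\<^sub>C b i x"
    and bs_scaleC: "i \<in> {1..d} \<Longrightarrow> bs i (c *\<^sub>C x) = c *\<^sub>C bs i x"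
    and adjoint: "i \<in> {1..d} \<Longrightarrow> cinner (b i x) y = cinner x (bs i y)"
    and norm_b_le: "i \<in> {1..d} \<Longrightarrow> norm (b i x) \<le> norm x"
    and bs_b: "i \<in> {1..d} \<Longrightarrow> j \<in> {1..d} \<Longrightarrow> i \<noteq> j \<Longrightarrow>
      bs i (b j x) = complex_of_real \<mu> *\<^sub>C b j (bs i x)"
    and bs_bs: "i \<in> {1..d} \<Longrightarrow> j \<in> {1..d} \<Longrightarrow> i < j \<Longrightarrow>
      bs i (bs j x) = complex_of_real \<mu> *\<^sub>C bs j (bs i x)"
    and bs_b_same: "i \<in> {1..d} \<Longrightarrow> (\<And>j. j \<in> {1..<i} \<Longrightarrow> bs j x = 0) \<Longrightarrow>
      bs i (b i x) = complex_of_real (1 - \<mu>\<^sup>2) *\<^sub>C x + complex_of_real (\<mu>\<^sup>2) *\<^sub>C b i (bs i x)"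
    and norm_vacuum: "norm \<Omega> = 1"
    and vacuum: "i \<in> {1..d} \<Longrightarrow> bs i \<Omega> = 0"
begin

text \<open>Powers of \<open>b i\<close> map \<open>kernel_below (Suc i)\<close> into
  \<open>kernel_below i\<close>. Starting from the vacuum, vectors
  \<open>b_i^r_i ... b_d^r_d \<Omega>\<close> are thus built from the last variable
  backwards.\<close>

definition kernel_below :: "nat \<Rightarrow> 'h set"
  where "kernel_below i = {u. \<forall>j\<in>{1..<i}. bs j u = 0}"

text \<open>The adjoint of the ordered product \<open>b_i^n_i b_(i+1)^n_(i+1) ...\<close>, which is
  why the power of \<open>bs i\<close> is applied first.\<close>

fun annih :: "nat \<Rightarrow> nat list \<Rightarrow> 'h \<Rightarrow> 'h" where
  "annih i [] u = u"
| "annih i (n # ns) u = annih (Suc i) ns ((bs i ^^ n) u)"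

lemma q_bounds: "0 \<le> \<mu>\<^sup>2" "\<mu>\<^sup>2 < 1"
  using \<mu> by (auto simp: abs_square_less_1)

lemma b_zero: "i \<in> {1..d} \<Longrightarrow> b i 0 = 0"
  using b_scaleC[of i 0 0] by simp

lemma bs_zero: "i \<in> {1..d} \<Longrightarrow> bs i 0 = 0"
  using bs_scaleC[of i 0 0] by simp

section \<open>Commutation of powers of the operators and their adjoints\<close>

lemma bs_pow_scaleC: "i \<in> {1..d} \<Longrightarrow> (bs i ^^ n) (c *\<^sub>C x) = c *\<^sub>C (bs i ^^ n) x"
  by (induction n) (auto simp: bs_scaleC)

lemma b_pow_zero: "i \<in> {1..d} \<Longrightarrow> (b i ^^ n) 0 = 0"
  by (induction n) (auto simp: b_zero)

lemma norm_b_pow_le: "i \<in> {1..d} \<Longrightarrow> norm ((b i ^^ n) x) \<le> norm x"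
  by (induction n) (auto intro: order_trans[OF norm_b_le])

lemma adjoint_pow: "i \<in> {1..d} \<Longrightarrow> cinner ((b i ^^ n) x) y = cinner x ((bs i ^^ n) y)"
proof (induction n arbitrary: y)
  case (Suc n)
  have "(bs i ^^ Suc n) y = (bs i ^^ n) (bs i y)"
    by (simp add: funpow_swap1)
  thus ?case using Suc by (simp add: adjoint del: funpow.simps(2)) (simp add: adjoint)
qed simp

lemma bs_b_pow:
  assumes "i \<in> {1..d}" "j \<in> {1..d}" "i \<noteq> j"
  shows "bs i ((b j ^^ l) x) = complex_of_real (\<mu> ^ l) *\<^sub>C (b j ^^ l) (bs i x)"
  using assms by (induction l) (auto simp: bs_b b_scaleC scaleC_scaleC mult_ac)

lemma bs_pow_b_pow:
  assumes "i \<in> {1..d}" "j \<in> {1..d}" "i \<noteq> j"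
  shows "(bs i ^^ n) ((b j ^^ l) x) = complex_of_real (\<mu> ^ (l * n)) *\<^sub>C (b j ^^ l) ((bs i ^^ n) x)"
  using assms
  by (induction n) (auto simp: bs_b_pow bs_scaleC scaleC_scaleC power_add mult_ac)

lemma bs_bs_pow:
  assumes "i \<in> {1..d}" "j \<in> {1..d}" "i < j"
  shows "bs i ((bs j ^^ n) x) = complex_of_real (\<mu> ^ n) *\<^sub>C (bs j ^^ n) (bs i x)"
  using assms by (induction n) (auto simp: bs_bs bs_scaleC scaleC_scaleC mult_ac)

lemma annih_scaleC:
  "1 \<le> i \<Longrightarrow> i + length ns \<le> Suc d \<Longrightarrow> annih i ns (c *\<^sub>C u) = c *\<^sub>C annih i ns u"
  by (induction i ns u rule: annih.induct) (auto simp: bs_pow_scaleC)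

text \<open>Each of the \<open>sum_list ns\<close> adjoints passes each of the \<open>l\<close>
  factors \<open>b i\<close> at the price of one \<open>\<mu>\<close>. This is the twist that
  \<open>coeff_functional\<close> has to undo.\<close>

lemma annih_b_pow:
  assumes "1 \<le> i" "i < j" "j + length ns \<le> Suc d"
  shows "annih j ns ((b i ^^ l) u) =
    complex_of_real (\<mu> ^ (l * sum_list ns)) *\<^sub>C (b i ^^ l) (annih j ns u)"
  using assms
  by (induction j ns u rule: annih.induct)
     (auto simp: bs_pow_b_pow annih_scaleC scaleC_scaleC power_add distrib_left mult_ac)

lemma b_pow_kernel_below:
  "i \<in> {1..d} \<Longrightarrow> u \<in> kernel_below i \<Longrightarrow> (b i ^^ l) u \<in> kernel_below i"
  by (auto simp: kernel_below_def bs_b_pow b_pow_zero)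

lemma kernel_below_antimono: "u \<in> kernel_below i \<Longrightarrow> j \<le> i \<Longrightarrow> u \<in> kernel_below j"
  by (auto simp: kernel_below_def)

lemma bs_pow_kernel_below:
  assumes "j \<in> {1..d}" "i \<le> j" "u \<in> kernel_below i"
  shows "(bs j ^^ n) u \<in> kernel_below i"
proof -
  have "(bs j ^^ n) 0 = 0"
    using bs_pow_scaleC[OF assms(1), of n 0 0] by simp
  thus ?thesis
    using assms by (auto simp: kernel_below_def bs_bs_pow)
qed

lemma annih_kernel_below:
  assumes "1 \<le> j" "i \<le> j" "j + length ns \<le> Suc d" "u \<in> kernel_below i"
  shows "annih j ns u \<in> kernel_below i"
  using assms
  by (induction j ns u rule: annih.induct) (auto simp: bs_pow_kernel_below)

text \<open>The \<open>q\<close>-derivative of a power. The one-variable relation can be reapplied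
  because powers of \<open>b i\<close> stay in \<open>kernel_below i\<close>; the factor obeys
  \<open>c_(s+1) = (1 - q) + q c_s\<close> with \<open>q = \<mu>\<^sup>2\<close>.\<close>

lemma bs_b_pow_same:
  assumes "i \<in> {1..d}" "u \<in> kernel_below (Suc i)"
  shows "bs i ((b i ^^ Suc s) u) = complex_of_real (1 - (\<mu>\<^sup>2) ^ Suc s) *\<^sub>C (b i ^^ s) u"
proof (induction s)
  case 0
  have "bs i u = 0"
    using assms by (auto simp: kernel_below_def)
  thus ?case
    using assms bs_b_same[of i u] by (auto simp: kernel_below_def b_zero)
next
  case (Suc s)
  define v where "v = (b i ^^ Suc s) u"
  have "v \<in> kernel_below i"
    unfolding v_def using assms by (intro b_pow_kernel_below kernel_below_antimono[OF assms(2)]) auto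
  hence "bs i (b i v) = complex_of_real (1 - \<mu>\<^sup>2) *\<^sub>C v + complex_of_real (\<mu>\<^sup>2) *\<^sub>C b i (bs i v)"
    using assms by (intro bs_b_same) (auto simp: kernel_below_def)
  also have "bs i v = complex_of_real (1 - (\<mu>\<^sup>2) ^ Suc s) *\<^sub>C (b i ^^ s) u"
    unfolding v_def by (rule Suc.IH)
  also have "b i \<dots> = complex_of_real (1 - (\<mu>\<^sup>2) ^ Suc s) *\<^sub>C v"
    using assms by (simp add: b_scaleC v_def)
  finally have "bs i (b i v) = complex_of_real (1 - \<mu>\<^sup>2) *\<^sub>C v +
      (complex_of_real (\<mu>\<^sup>2) * complex_of_real (1 - (\<mu>\<^sup>2) ^ Suc s)) *\<^sub>C v"
    by (simp only: scaleC_scaleC)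
  also have "\<dots> = complex_of_real (1 - (\<mu>\<^sup>2) ^ Suc (Suc s)) *\<^sub>C v"
    by (simp only: scaleC_add_left[symmetric]) (simp add: algebra_simps)
  finally show ?case
    by (simp add: v_def)
qed

lemma bs_pow_b_pow_same:
  assumes "i \<in> {1..d}" "u \<in> kernel_below (Suc i)"
  shows "(bs i ^^ n) ((b i ^^ t) u) =
    (if n \<le> t then complex_of_real (qpoch (\<mu>\<^sup>2) t / qpoch (\<mu>\<^sup>2) (t - n)) *\<^sub>C (b i ^^ (t - n)) u
     else 0)"
proof (induction n)
  case 0
  thus ?case using qpoch_pos[OF q_bounds, of t] by simp
next
  case (Suc n)
  consider "Suc n \<le> t" | "t = n" | "t < n" by linarith
  thus ?case
  proof cases
    case 1
    then obtain s where s: "t - n = Suc s" "t - Suc n = s"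
      by (metis Suc_diff_Suc Suc_le_lessD)
    have "(bs i ^^ Suc n) ((b i ^^ t) u) =
        complex_of_real (qpoch (\<mu>\<^sup>2) t / qpoch (\<mu>\<^sup>2) (Suc s)) *\<^sub>C bs i ((b i ^^ Suc s) u)"
      using Suc 1 assms s by (simp add: bs_scaleC del: of_real_divide)
    also have "\<dots> = complex_of_real (qpoch (\<mu>\<^sup>2) t / qpoch (\<mu>\<^sup>2) (Suc s) * (1 - (\<mu>\<^sup>2) ^ Suc s)) *\<^sub>C (b i ^^ s) u"
      by (simp only: bs_b_pow_same[OF assms] scaleC_scaleC of_real_mult)
    also have "qpoch (\<mu>\<^sup>2) t / qpoch (\<mu>\<^sup>2) (Suc s) * (1 - (\<mu>\<^sup>2) ^ Suc s) =
        qpoch (\<mu>\<^sup>2) t / qpoch (\<mu>\<^sup>2) s"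
      using qpoch_pos[OF q_bounds, of s] qpoch_pos[OF q_bounds, of "Suc s"]
      by (simp add: qpoch_Suc divide_simps zero_less_mult_iff del: power_Suc)
    finally show ?thesis
      using 1 s by simp
  next
    case 2
    hence "(bs i ^^ Suc n) ((b i ^^ t) u) = complex_of_real (qpoch (\<mu>\<^sup>2) t) *\<^sub>C bs i u"
      using Suc assms by (simp add: bs_scaleC)
    thus ?thesis
      using 2 assms by (auto simp: kernel_below_def)
  next
    case 3
    thus ?thesis using Suc assms by (simp add: bs_zero)
  qed
qed

text \<open>The larger power is moved across as adjoints; these exhaust the smaller power and then
  annihilate the vector beneath it.\<close>

lemma cinner_b_pow:
  assumes i: "i \<in> {1..d}" and xy: "x \<in> kernel_below (Suc i)" "y \<in> kernel_below (Suc i)"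
  shows "cinner ((b i ^^ l) x) ((b i ^^ m) y) =
    (if l = m then complex_of_real (qpoch (\<mu>\<^sup>2) l) * cinner x y else 0)"
proof -
  have less: "cinner ((b i ^^ l) x) ((b i ^^ m) y) = 0"
    if "m < l" "x \<in> kernel_below (Suc i)" "y \<in> kernel_below (Suc i)" for l m x y
    using that bs_pow_b_pow_same[OF i that(3), of l m] adjoint_pow[OF i, of l x] by simp
  consider "m < l" | "l < m" | "l = m" by linarith
  thus ?thesis
  proof cases
    case 1
    thus ?thesis using less xy by simp
  next
    case 2
    have "cinner ((b i ^^ m) y) ((b i ^^ l) x) = 0"
      using less[OF 2] xy by simp
    thus ?thesis using 2 cinner_commute[of "(b i ^^ l) x"] by simp
  next
    case 3
    thus ?thesis
      using bs_pow_b_pow_same[OF i xy(2), of l l] adjoint_pow[OF i, of l x]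
      by (simp add: cinner_scaleC_right)
  qed
qed

text \<open>The functional that reads off the coefficient of \<open>b\<^sup>r (b\<^sup>s)\<^sup>*\<close> (multi-indices \<open>r\<close>, \<open>s\<close>) in the form
  \<open>B\<close> of a polynomial in Wick order. In a single variable the matrix element of
  \<open>b\<^sup>m (b\<^sup>n)\<^sup>*\<close> between \<open>b\<^sup>n\<^sup>+\<^sup>l \<Omega>\<close> and \<open>b\<^sup>m\<^sup>+\<^sup>l \<Omega>\<close> depends, after normalisation, on \<open>l\<close> only and equals
  \<open>1 / (q; q)\<^sub>l\<close>; the weights invert this convolution. A further variable twists
  the matrix elements by powers of \<open>\<mu>\<close>.\<close>

fun coeff_functional :: "nat \<Rightarrow> nat list \<Rightarrow> nat list \<Rightarrow> ('h \<Rightarrow> 'h \<Rightarrow> complex) \<Rightarrow> complex" where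
  "coeff_functional i (r # rs) (s # ss) B =
    (\<Sum>k\<le>min r s. complex_of_real (qweight (\<mu>\<^sup>2) k * \<mu> ^ (k * (sum_list rs + sum_list ss)) /
        (qpoch (\<mu>\<^sup>2) (r - k) * qpoch (\<mu>\<^sup>2) (s - k))) *
      coeff_functional (Suc i) rs ss (\<lambda>u v. B ((b i ^^ (s - k)) u) ((b i ^^ (r - k)) v)))"
| "coeff_functional i _ _ B = B \<Omega> \<Omega>"

text \<open>The functional evaluates its form only at vectors generated from the vacuum, which lie
  in \<open>kernel_below\<close>. Formulas valid only there may therefore be substituted into
  it.\<close>

lemma coeff_functional_cong:
  assumes "1 \<le> i" "i + length rs \<le> Suc d" "length ss = length rs"
    and "\<And>u v. u \<in> kernel_below i \<Longrightarrow> v \<in> kernel_below i \<Longrightarrow> B u v = B' u v"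
  shows "coeff_functional i rs ss B = coeff_functional i rs ss B'"
  using assms
proof (induction rs arbitrary: i ss B B')
  case Nil
  have "\<Omega> \<in> kernel_below i"
    using Nil vacuum by (auto simp: kernel_below_def)
  thus ?case using Nil by simp
next
  case (Cons r rs)
  then obtain s ss' where ss: "ss = s # ss'"
    by (cases ss) auto
  have "coeff_functional (Suc i) rs ss' (\<lambda>u v. B ((b i ^^ (s - k)) u) ((b i ^^ (r - k)) v)) =
      coeff_functional (Suc i) rs ss' (\<lambda>u v. B' ((b i ^^ (s - k)) u) ((b i ^^ (r - k)) v))" for k
    using Cons.prems ss
    by (intro Cons.IH Cons.prems(4) b_pow_kernel_below) (auto intro: kernel_below_antimono)
  thus ?case by (simp add: ss)
qed

lemma coeff_functional_sum:
  "finite I \<Longrightarrow> length ss = length rs \<Longrightarrow> coeff_functional i rs ss (\<lambda>u v. \<Sum>x\<in>I. c x * B x u v) =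
    (\<Sum>x\<in>I. c x * coeff_functional i rs ss (B x))"
proof (induction rs arbitrary: i ss B)
  case (Cons r rs)
  then obtain s ss' where ss: "ss = s # ss'"
    by (cases ss) auto
  show ?case
    using Cons by (simp add: ss sum_distrib_left sum_distrib_right mult_ac del: of_real_mult of_real_divide)
       (rule sum.swap)
qed simp

lemma coeff_functional_mult:
  "length ss = length rs \<Longrightarrow> coeff_functional i rs ss (\<lambda>u v. c * B u v) =
    c * coeff_functional i rs ss B"
  using coeff_functional_sum[of "{()}" ss rs i "\<lambda>_. c" "\<lambda>_. B"] by simp

text \<open>Every variable contributes a sum of at most \<open>D + 1\<close> terms with weights at
  most \<open>K\<close>. The cube in \<open>K\<close> covers \<open>qweight\<close> and the two
  reciprocal Pochhammer symbols; powers of \<open>\<mu>\<close> have modulus at most 1, and the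
  operators \<open>b i\<close> are contractions, so the inner form keeps the bound
  \<open>\<beta>\<close>.\<close>

lemma coeff_functional_bound:
  fixes D :: nat
  defines "K \<equiv> exp (1 / (1 - \<mu>\<^sup>2)\<^sup>2) ^ 3"
  assumes "1 \<le> i" "i + length rs \<le> Suc d" "length ss = length rs"
    and "\<And>u v. cmod (B u v) \<le> \<beta> * norm u * norm v" and "0 \<le> \<beta>" and "\<And>r. r \<in> set rs \<Longrightarrow> r \<le> D"
  shows "cmod (coeff_functional i rs ss B) \<le> (real (Suc D) * K) ^ length rs * \<beta>"
  using assms(2-)
proof (induction rs arbitrary: i ss B)
  case Nil
  thus ?case
    using Nil.prems(4)[of \<Omega> \<Omega>] by (simp add: norm_vacuum)
next
  case (Cons r rs)
  then obtain s ss' where ss: "ss = s # ss'"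
    by (cases ss) auto
  define M where "M = (real (Suc D) * K) ^ length rs * \<beta>"
  have K: "0 \<le> K" by (simp add: K_def)
  have M: "0 \<le> M" using K Cons.prems by (simp add: M_def)
  have i: "i \<in> {1..d}" using Cons.prems by auto
  have inner: "cmod (coeff_functional (Suc i) rs ss' (\<lambda>u v. B ((b i ^^ (s - k)) u) ((b i ^^ (r - k)) v))) \<le> M" for k
    unfolding M_def
  proof (rule Cons.IH)
    fix u v
    have "cmod (B ((b i ^^ (s - k)) u) ((b i ^^ (r - k)) v)) \<le>
        \<beta> * norm ((b i ^^ (s - k)) u) * norm ((b i ^^ (r - k)) v)"
      by (rule Cons.prems)
    also have "\<dots> \<le> \<beta> * norm u * norm v"
      using Cons.prems i by (intro mult_mono norm_b_pow_le) auto
    finally show "cmod (B ((b i ^^ (s - k)) u) ((b i ^^ (r - k)) v)) \<le> \<beta> * norm u * norm v" .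
  qed (use Cons.prems ss in auto)
  have coeff: "\<bar>qweight (\<mu>\<^sup>2) k * \<mu> ^ n / (qpoch (\<mu>\<^sup>2) l * qpoch (\<mu>\<^sup>2) m)\<bar> \<le> K" for k n l m
  proof -
    have "\<bar>qweight (\<mu>\<^sup>2) k * \<mu> ^ n / (qpoch (\<mu>\<^sup>2) l * qpoch (\<mu>\<^sup>2) m)\<bar> =
        \<bar>qweight (\<mu>\<^sup>2) k\<bar> * \<bar>\<mu>\<bar> ^ n * (1 / qpoch (\<mu>\<^sup>2) l) * (1 / qpoch (\<mu>\<^sup>2) m)"
      using qpoch_pos[OF q_bounds, of l] qpoch_pos[OF q_bounds, of m]
      by (simp add: abs_mult power_abs)
    also have "\<dots> \<le> exp (1 / (1 - \<mu>\<^sup>2)\<^sup>2) * 1 * exp (1 / (1 - \<mu>\<^sup>2)\<^sup>2) * exp (1 / (1 - \<mu>\<^sup>2)\<^sup>2)"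
      using qpoch_pos[OF q_bounds, of l] qpoch_pos[OF q_bounds, of m] \<mu>
      by (intro mult_mono abs_qweight_le inverse_qpoch_le q_bounds power_le_one)
         (auto intro!: mult_nonneg_nonneg)
    finally show ?thesis
      by (simp add: K_def power3_eq_cube)
  qed
  have "cmod (coeff_functional i (r # rs) ss B) \<le> (\<Sum>k\<le>min r s. K * M)"
    unfolding ss coeff_functional.simps
    by (intro sum_norm_le) (auto simp only: norm_mult norm_of_real intro!: mult_mono coeff inner K M norm_ge_zero)
  also have "\<dots> = real (Suc (min r s)) * (K * M)"
    by simp
  also have "\<dots> \<le> real (Suc D) * (K * M)"
    using K M Cons.prems(6)[of r] by (intro mult_right_mono) auto
  finally show ?case
    by (simp add: M_def mult_ac)
qed

text \<open>The functionals are dual to the Wick monomials. On the relevant vectors the variable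
  \<open>i\<close> splits off as a scalar times the same form in the later variables, which the
  induction hypothesis evaluates. The weights cancel the Pochhammer factors of that scalar, and the
  sum over \<open>k\<close> becomes the convolution of \<open>qweight_convolution\<close>.\<close>

lemma coeff_functional_monomial:
  assumes "1 \<le> i" "i + length rs \<le> Suc d"
    and "length ss = length rs" "length ms = length rs" "length ns = length rs"
  shows "coeff_functional i rs ss (\<lambda>u v. cinner (annih i ns u) (annih i ms v)) =
    (if ms = rs \<and> ns = ss then 1 else 0)"
  using assms
proof (induction rs arbitrary: i ss ms ns)
  case Nil
  thus ?case by (simp add: cinner_self norm_vacuum)
next
  case (Cons r rs)
  obtain s ss' m ms' n ns' where eqs: "ss = s # ss'" "ms = m # ms'" "ns = n # ns'"
    using Cons.prems by (cases ss; cases ms; cases ns) auto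
  have lens: "length ss' = length rs" "length ms' = length rs" "length ns' = length rs"
    using Cons.prems eqs by auto
  have i: "i \<in> {1..d}" and i': "1 \<le> Suc i" "Suc i + length rs \<le> Suc d"
    using Cons.prems by auto
  let ?q = "\<mu>\<^sup>2"
  let ?P = "sum_list rs + sum_list ss'"
  define \<delta> :: complex where "\<delta> = (if ms' = rs \<and> ns' = ss' then 1 else 0)"
  have IH: "coeff_functional (Suc i) rs ss' (\<lambda>u v. cinner (annih (Suc i) ns' u) (annih (Suc i) ms' v)) = \<delta>"
    unfolding \<delta>_def using Cons.IH[of "Suc i" ss' ms' ns'] i' lens by simp
  \<comment> \<open>The two applications of \<open>bs_pow_b_pow_same\<close> give two equal
    denominators; one of them cancels against the norm factor from \<open>cinner_b_pow\<close>, so a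
    single \<open>qpoch ?q (t - n)\<close> is left.\<close>
  have form: "cinner (annih (Suc i) ns' ((bs i ^^ n) ((b i ^^ t) u)))
        (annih (Suc i) ms' ((bs i ^^ m) ((b i ^^ p) v))) =
      (if n \<le> t \<and> m \<le> p \<and> t - n = p - m
       then complex_of_real (qpoch ?q t * qpoch ?q p / qpoch ?q (t - n) *
          \<mu> ^ ((t - n) * (sum_list ns' + sum_list ms'))) else 0) *
      cinner (annih (Suc i) ns' u) (annih (Suc i) ms' v)"
    if uv: "u \<in> kernel_below (Suc i)" "v \<in> kernel_below (Suc i)" for t p u v
  proof (cases "n \<le> t \<and> m \<le> p")
    case True
    define x y where "x = annih (Suc i) ns' u" and "y = annih (Suc i) ms' v"
    have xy: "x \<in> kernel_below (Suc i)" "y \<in> kernel_below (Suc i)"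
      unfolding x_def y_def using uv i' lens by (auto intro!: annih_kernel_below)
    have 1: "annih (Suc i) ns' ((bs i ^^ n) ((b i ^^ t) u)) =
        complex_of_real (qpoch ?q t / qpoch ?q (t - n) * \<mu> ^ ((t - n) * sum_list ns')) *\<^sub>C (b i ^^ (t - n)) x"
      unfolding bs_pow_b_pow_same[OF i uv(1)] x_def
      using True i i' lens
      by (simp add: annih_scaleC annih_b_pow scaleC_scaleC)
    have 2: "annih (Suc i) ms' ((bs i ^^ m) ((b i ^^ p) v)) =
        complex_of_real (qpoch ?q p / qpoch ?q (p - m) * \<mu> ^ ((p - m) * sum_list ms')) *\<^sub>C (b i ^^ (p - m)) y"
      unfolding bs_pow_b_pow_same[OF i uv(2)] y_def
      using True i i' lens
      by (simp add: annih_scaleC annih_b_pow scaleC_scaleC)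
    show ?thesis
    proof (cases "t - n = p - m")
      case eq: True
      have "qpoch ?q (p - m) \<noteq> 0"
        using qpoch_pos[OF q_bounds, of "p - m"] by simp
      thus ?thesis
        unfolding 1 2 using True
        by (simp add: eq cinner_scaleC_left cinner_scaleC_right cinner_b_pow[OF i xy] x_def[symmetric]
            y_def[symmetric] power_add distrib_left)
    next
      case False
      thus ?thesis
        unfolding 1 2
        by (simp add: cinner_scaleC_left cinner_scaleC_right cinner_b_pow[OF i xy])
    qed
  next
    case False
    have "annih (Suc i) ns' 0 = 0" "annih (Suc i) ms' 0 = 0"
      using annih_scaleC[of "Suc i" ns' 0 0] annih_scaleC[of "Suc i" ms' 0 0] i' lens by simp_all
    thus ?thesis
      using False by (auto simp: bs_pow_b_pow_same[OF i uv(1)] bs_pow_b_pow_same[OF i uv(2)])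
  qed
  \<comment> \<open>The exponent of \<open>\<mu>\<close> no longer depends on \<open>k\<close>,
    since \<open>k + (s - k - n) = s - n\<close>: this is the reason for the power of
    \<open>\<mu>\<close> in the weights. The factor \<open>\<delta>\<close> makes the exponents of
    the later variables agree, so that both twists are multiples of \<open>?P\<close>.\<close>
  have summand: "complex_of_real (qweight ?q k * \<mu> ^ (k * ?P) / (qpoch ?q (r - k) * qpoch ?q (s - k))) *
      coeff_functional (Suc i) rs ss' (\<lambda>u v. cinner (annih i ns ((b i ^^ (s - k)) u)) (annih i ms ((b i ^^ (r - k)) v))) =
      (if n \<le> s - k \<and> m \<le> r - k \<and> s - k - n = r - k - m
       then complex_of_real (\<mu> ^ ((s - n) * ?P) * (qweight ?q k / qpoch ?q (s - n - k))) * \<delta> else 0)"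
    if k: "k \<le> min r s" for k
  proof -
    have "coeff_functional (Suc i) rs ss' (\<lambda>u v. cinner (annih i ns ((b i ^^ (s - k)) u)) (annih i ms ((b i ^^ (r - k)) v))) =
      coeff_functional (Suc i) rs ss' (\<lambda>u v.
      (if n \<le> s - k \<and> m \<le> r - k \<and> s - k - n = r - k - m
       then complex_of_real (qpoch ?q (s - k) * qpoch ?q (r - k) / qpoch ?q (s - k - n) *
          \<mu> ^ ((s - k - n) * (sum_list ns' + sum_list ms'))) else 0) *
      cinner (annih (Suc i) ns' u) (annih (Suc i) ms' v))"
      unfolding eqs annih.simps using i' lens by (intro coeff_functional_cong form) auto
    also have "\<dots> = (if n \<le> s - k \<and> m \<le> r - k \<and> s - k - n = r - k - m
       then complex_of_real (qpoch ?q (s - k) * qpoch ?q (r - k) / qpoch ?q (s - k - n) *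
          \<mu> ^ ((s - k - n) * (sum_list ns' + sum_list ms'))) else 0) * \<delta>"
      by (simp only: coeff_functional_mult[OF lens(1)] IH)
    finally have *: "coeff_functional (Suc i) rs ss' (\<lambda>u v. cinner (annih i ns ((b i ^^ (s - k)) u)) (annih i ms ((b i ^^ (r - k)) v))) =
      (if n \<le> s - k \<and> m \<le> r - k \<and> s - k - n = r - k - m
       then complex_of_real (qpoch ?q (s - k) * qpoch ?q (r - k) / qpoch ?q (s - k - n) *
          \<mu> ^ ((s - k - n) * (sum_list ns' + sum_list ms'))) else 0) * \<delta>" .
    show ?thesis
    proof (cases "n \<le> s - k \<and> m \<le> r - k \<and> s - k - n = r - k - m \<and> ms' = rs \<and> ns' = ss'")
      case True
      have cond: "n \<le> s - k \<and> m \<le> r - k \<and> s - k - n = r - k - m" and eq: "ms' = rs" "ns' = ss'"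
        using True by blast+
      have ne: "qpoch ?q (s - k) \<noteq> 0" "qpoch ?q (r - k) \<noteq> 0"
        using qpoch_pos[OF q_bounds, of "s - k"] qpoch_pos[OF q_bounds, of "r - k"] by auto
      have "k + (s - k - n) = s - n"
        using True k by linarith
      hence "k * ?P + (s - k - n) * ?P = (s - n) * ?P"
        by (simp only: distrib_right[symmetric])
      hence pw: "\<mu> ^ (k * ?P) * \<mu> ^ ((s - k - n) * ?P) = \<mu> ^ ((s - n) * ?P)"
        by (simp only: power_add[symmetric])
      have "qweight ?q k * \<mu> ^ (k * ?P) / (qpoch ?q (r - k) * qpoch ?q (s - k)) *
          (qpoch ?q (s - k) * qpoch ?q (r - k) / qpoch ?q (s - k - n) * \<mu> ^ ((s - k - n) * ?P)) =
          \<mu> ^ ((s - n) * ?P) * (qweight ?q k / qpoch ?q (s - n - k))"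
        unfolding pw[symmetric] using ne by (simp add: add.commute mult_ac)
      from arg_cong[OF this, of "\<lambda>x. complex_of_real x * \<delta>"] show ?thesis
        unfolding * if_P[OF cond] eq add.commute[of "sum_list ss'" "sum_list rs"]
        by (simp only: of_real_mult mult.assoc)
    qed (auto simp: * \<delta>_def)
  qed
  have "coeff_functional i (r # rs) ss (\<lambda>u v. cinner (annih i ns u) (annih i ms v)) =
    (\<Sum>k\<le>min r s. if n \<le> s - k \<and> m \<le> r - k \<and> s - k - n = r - k - m
       then complex_of_real (\<mu> ^ ((s - n) * ?P) * (qweight ?q k / qpoch ?q (s - n - k))) * \<delta> else 0)"
    unfolding eqs(1) coeff_functional.simps by (intro sum.cong refl summand) auto
  \<comment> \<open>Some \<open>k\<close> meets the condition only if \<open>n \<le> s\<close>,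
    \<open>m \<le> r\<close> and \<open>s - n = r - m\<close>, and then exactly the
    \<open>k \<le> s - n\<close> do. The inequalities have to be kept because subtraction is
    truncated.\<close>
  also have "\<dots> = (if m = r \<and> n = s then 1 else 0) * \<delta>"
  proof (cases "n \<le> s \<and> m \<le> r \<and> s - n = r - m")
    case True
    have "(\<Sum>k\<le>min r s. if n \<le> s - k \<and> m \<le> r - k \<and> s - k - n = r - k - m
       then complex_of_real (\<mu> ^ ((s - n) * ?P) * (qweight ?q k / qpoch ?q (s - n - k))) * \<delta> else 0) =
      (\<Sum>k\<le>s - n. complex_of_real (\<mu> ^ ((s - n) * ?P) * (qweight ?q k / qpoch ?q (s - n - k))) * \<delta>)"
    proof (rule sum.mono_neutral_cong_right)
      show "{..s - n} \<subseteq> {..min r s}"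
        using True by (simp add: subset_iff) linarith
      show "\<forall>k\<in>{..min r s} - {..s - n}. (if n \<le> s - k \<and> m \<le> r - k \<and> s - k - n = r - k - m
       then complex_of_real (\<mu> ^ ((s - n) * ?P) * (qweight ?q k / qpoch ?q (s - n - k))) * \<delta> else 0) = 0"
      proof
        fix k assume "k \<in> {..min r s} - {..s - n}"
        hence "\<not> n \<le> s - k" by (simp, linarith)
        thus "(if n \<le> s - k \<and> m \<le> r - k \<and> s - k - n = r - k - m
       then complex_of_real (\<mu> ^ ((s - n) * ?P) * (qweight ?q k / qpoch ?q (s - n - k))) * \<delta> else 0) = 0"
          by (simp only: simp_thms if_False)
      qed
      fix k assume "k \<in> {..s - n}"
      hence "n \<le> s - k \<and> m \<le> r - k \<and> s - k - n = r - k - m"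
        using True by (simp only: atMost_iff) linarith
      thus "(if n \<le> s - k \<and> m \<le> r - k \<and> s - k - n = r - k - m
       then complex_of_real (\<mu> ^ ((s - n) * ?P) * (qweight ?q k / qpoch ?q (s - n - k))) * \<delta> else 0) =
        complex_of_real (\<mu> ^ ((s - n) * ?P) * (qweight ?q k / qpoch ?q (s - n - k))) * \<delta>"
        by (simp only: simp_thms if_True)
    qed simp
    also have "\<dots> = complex_of_real (\<mu> ^ ((s - n) * ?P) * (\<Sum>k\<le>s - n. qweight ?q k / qpoch ?q (s - n - k))) * \<delta>"
      by (simp add: sum_distrib_left sum_distrib_right)
    also have "\<dots> = (if m = r \<and> n = s then 1 else 0) * \<delta>"
    proof -
      have "s - n = 0 \<longleftrightarrow> m = r \<and> n = s"
        using True by linarith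
      thus ?thesis
        unfolding qweight_convolution[OF q_bounds] by simp
    qed
    finally show ?thesis .
  next
    case False
    hence "\<not> (n \<le> s - k \<and> m \<le> r - k \<and> s - k - n = r - k - m)" if "k \<le> min r s" for k
      using that by (simp only: min.bounded_iff) linarith
    hence "(\<Sum>k\<le>min r s. if n \<le> s - k \<and> m \<le> r - k \<and> s - k - n = r - k - m
       then complex_of_real (\<mu> ^ ((s - n) * ?P) * (qweight ?q k / qpoch ?q (s - n - k))) * \<delta> else 0) = 0"
      by (intro sum.neutral ballI) (simp only: atMost_iff simp_thms if_False)
    moreover have "\<not> (m = r \<and> n = s)"
      using False by linarith
    ultimately show ?thesis
      by (simp only: simp_thms if_False mult_zero_left)
  qed
  also have "\<dots> = (if ms = r # rs \<and> ns = ss then 1 else 0)"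
    by (auto simp: \<delta>_def eqs)
  finally show ?case .
qed

end

section \<open>Elementary facts on C*-algebras\<close>

text \<open>If \<open>y < x\<close>, then \<open>(x / y)^n\<close> outgrows \<open>n^p\<close>.
  Exponents are restricted to \<open>2^k\<close> because iterating the C*-identity on a self-adjoint
  element yields just these.\<close>

lemma le_of_powers_le_polynomial:
  fixes x y C :: real
  assumes "0 \<le> y" and le: "\<And>k :: nat. x ^ (2 ^ k) \<le> C * real (2 ^ k) ^ p * y ^ (2 ^ k)"
  shows "x \<le> y"
proof (rule ccontr)
  assume "\<not> x \<le> y"
  hence "y < x" by simp
  have "0 < y"
    using le[of 0] \<open>y < x\<close> \<open>0 \<le> y\<close> by (cases "y = 0") auto
  define r where "r = x / y"
  have "1 < r"
    using \<open>y < x\<close> \<open>0 < y\<close> by (simp add: r_def)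
  have bound: "1 \<le> C * (real (2 ^ k) ^ p / r ^ (2 ^ k))" for k :: nat
  proof -
    have "r ^ (2 ^ k) \<le> C * real (2 ^ k) ^ p"
      using le[of k] \<open>0 < y\<close> by (simp add: r_def power_divide divide_simps)
    thus ?thesis
      using \<open>1 < r\<close> by (simp add: divide_simps)
  qed
  have "((\<lambda>n :: nat. C * (real n ^ p / r ^ n)) \<longlongrightarrow> 0) at_top"
    using \<open>1 < r\<close> by real_asymp
  moreover have "filterlim (\<lambda>k :: nat. 2 ^ k :: nat) at_top at_top"
    by (rule filterlim_subseq) (simp add: strict_mono_def)
  ultimately have "((\<lambda>k. C * (real (2 ^ k) ^ p / r ^ (2 ^ k))) \<longlongrightarrow> 0) at_top"
    by (rule filterlim_compose)
  hence "1 \<le> (0 :: real)"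
    by (rule LIMSEQ_le_const) (use bound in auto)
  thus False by simp
qed

context cstar_algebra
begin

lemma smult_closed [simp, intro]: "x \<in> carrier A \<Longrightarrow> c \<odot> x \<in> carrier A"
  using scalar.smult_closed[of c x] by (simp add: ring_of_type_algebra_def)

lemma smult_add_left: "x \<in> carrier A \<Longrightarrow> (b + c) \<odot> x = b \<odot> x \<oplus> c \<odot> x"
  using scalar.smult_l_distr[of b c x] by (simp add: ring_of_type_algebra_def)

lemma smult_add_right:
  "x \<in> carrier A \<Longrightarrow> y \<in> carrier A \<Longrightarrow> c \<odot> (x \<oplus> y) = c \<odot> x \<oplus> c \<odot> y"
  using scalar.smult_r_distr[of c x y] by (simp add: ring_of_type_algebra_def)

lemma smult_smult [simp]: "x \<in> carrier A \<Longrightarrow> b \<odot> (c \<odot> x) = (b * c) \<odot> x"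
  using scalar.smult_assoc1[of b c x] by (simp add: ring_of_type_algebra_def)

lemma smult_one [simp]: "x \<in> carrier A \<Longrightarrow> 1 \<odot> x = x"
  using scalar.smult_one[of x] by (simp add: ring_of_type_algebra_def)

lemma smult_zero_left [simp]: "x \<in> carrier A \<Longrightarrow> 0 \<odot> x = \<zero>"
  using scalar.smult_l_null[of x] by (simp add: ring_of_type_algebra_def)

lemma smult_zero_right [simp]: "c \<odot> \<zero> = \<zero>"
  using scalar.smult_r_null[of c] by (simp add: ring_of_type_algebra_def)

lemma minus_eq_smult: "y \<in> carrier A \<Longrightarrow> x \<ominus> y = x \<oplus> (- 1) \<odot> y"
  by (simp add: minus_eq smult_minus_one)

lemma star_zero [simp]: "star A \<zero> = \<zero>"
  using star_smult[of \<zero> 0] by (simp add: star_closed)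

lemma star_one [simp]: "star A \<one> = \<one>"
  using star_mult[of \<one> "star A \<one>"] by (simp add: star_closed star_star)

lemma star_pow: "x \<in> carrier A \<Longrightarrow> star A (x [^] (n :: nat)) = star A x [^] n"
proof (induction n)
  case (Suc n)
  thus ?case
    using nat_pow_Suc2[of "star A x" n] by (simp add: star_mult star_closed)
qed simp

lemma cnorm_zero [simp]: "cnorm A \<zero> = 0"
  by (simp add: cnorm_eq_0_iff)

lemma cnorm_nonneg: "x \<in> carrier A \<Longrightarrow> 0 \<le> cnorm A x"
  using cnorm_add[of x "(- 1) \<odot> x"] cnorm_smult[of x "- 1"]
  by (simp add: smult_minus_one r_neg)

lemma cnorm_star: "x \<in> carrier A \<Longrightarrow> cnorm A (star A x) = cnorm A x"
proof -
  have le: "cnorm A x \<le> cnorm A (star A x)" if x: "x \<in> carrier A" for x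
  proof (cases "cnorm A x = 0")
    case False
    have "cnorm A x * cnorm A x \<le> cnorm A (star A x) * cnorm A x"
      using cstar_identity[OF x] cnorm_mult[OF star_closed[OF x] x] by (simp add: power2_eq_square)
    thus ?thesis
      using cnorm_nonneg[OF x] False by (simp add: mult_le_cancel_right)
  qed (use x in \<open>simp add: cnorm_nonneg star_closed\<close>)
  show "x \<in> carrier A \<Longrightarrow> ?thesis"
    using le[of x] le[of "star A x"] by (simp add: star_closed star_star)
qed

text \<open>The C*-identity makes the norm of the unit idempotent; it is 0 in the zero algebra,
  hence an inequality.\<close>

lemma cnorm_one_le: "cnorm A \<one> \<le> 1"
  using cstar_identity[of \<one>] by (auto simp: power2_eq_square)

lemma cnorm_mult_le_one:
  "x \<in> carrier A \<Longrightarrow> y \<in> carrier A \<Longrightarrow> cnorm A x \<le> 1 \<Longrightarrow> cnorm A y \<le> 1 \<Longrightarrow> cnorm A (x \<otimes> y) \<le> 1"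
  using cnorm_mult[of x y] mult_mono[of "cnorm A x" 1 "cnorm A y" 1]
  by (simp add: cnorm_nonneg)

lemma cnorm_pow_le_one:
  "x \<in> carrier A \<Longrightarrow> cnorm A x \<le> 1 \<Longrightarrow> cnorm A (x [^] (n :: nat)) \<le> 1"
  by (induction n) (auto simp: cnorm_one_le intro!: cnorm_mult_le_one)

lemma cnorm_self_adjoint_pow:
  assumes x: "x \<in> carrier A" and "star A x = x"
  shows "cnorm A (x [^] (2 ^ k :: nat)) = cnorm A x ^ (2 ^ k)"
proof (induction k)
  case 0
  thus ?case using x by simp
next
  case (Suc k)
  have "x [^] (2 ^ Suc k :: nat) = star A (x [^] (2 ^ k :: nat)) \<otimes> x [^] (2 ^ k :: nat)"
    using assms by (simp add: star_pow nat_pow_mult mult_2)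
  thus ?case
    using Suc x cstar_identity[of "x [^] (2 ^ k :: nat)"] by (simp add: power_mult[symmetric] mult.commute)
qed

lemma cnorm_finsum_le:
  "finite I \<Longrightarrow> f \<in> I \<rightarrow> carrier A \<Longrightarrow> cnorm A (\<Oplus>k\<in>I. f k) \<le> (\<Sum>k\<in>I. cnorm A (f k))"
proof (induction I rule: finite_induct)
  case (insert k I)
  thus ?case
    using cnorm_add[of "f k" "finsum A f I"] by (simp add: Pi_iff)
qed simp

text \<open>In place of a Neumann series, \<open>g\<close> is the fixed point of the contraction
  \<open>x \<mapsto> \<one> \<oplus> x \<otimes> h\<close>; the fixed point equation says
  \<open>g (1 - h) = 1\<close>.\<close>

lemma left_inverse_one_minus:
  assumes h: "h \<in> carrier A" and "cnorm A h < 1"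
  obtains g where "g \<in> carrier A" and "\<one> \<oplus> g \<otimes> h = g"
proof -
  interpret M: Metric_space "carrier A" "norm_dist A"
    by (rule Metric_space_norm_dist)
  have "norm_dist A (\<one> \<oplus> x \<otimes> h) (\<one> \<oplus> y \<otimes> h) \<le> cnorm A h * norm_dist A x y"
    if xy: "x \<in> carrier A" "y \<in> carrier A" for x y
  proof -
    have "(\<one> \<oplus> x \<otimes> h) \<ominus> (\<one> \<oplus> y \<otimes> h) = (x \<ominus> y) \<otimes> h"
      using xy h
      by (simp add: minus_eq l_distr minus_add l_minus a_assoc r_neg2 a_comm[of \<one> "x \<otimes> h"])
    thus ?thesis
      using xy h cnorm_mult[of "x \<ominus> y" h] by (simp add: norm_dist_def mult.commute)
  qed
  thus thesis
    using that h M.Banach_fixedpoint_thm[of "\<lambda>g. \<one> \<oplus> g \<otimes> h" "cnorm A h"] complete assms(2)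
    by (metis (no_types, lifting) Pi_I a_closed empty_iff m_closed one_closed)
qed

text \<open>The case \<open>b\<^sup>* b = (1 - q) T + q b b\<^sup>*\<close> of the relations. With \<open>R = T - b b\<^sup>*\<close> one has
  \<open>R b = q b R\<close>, hence \<open>R\<^sup>N\<^sup>+\<^sup>1 = R\<^sup>N T - q\<^sup>N b R\<^sup>N b\<^sup>*\<close> and so the powers of the self-adjoint \<open>R\<close> are bounded.\<close>

lemma contractive_q_relation:
  fixes q :: real
  assumes T: "T \<in> carrier A" "star A T = T" "cnorm A T \<le> 1"
    and b: "b \<in> carrier A" "T \<otimes> b = b \<otimes> T"
    and rel: "star A b \<otimes> b = complex_of_real (1 - q) \<odot> T \<oplus> complex_of_real q \<odot> (b \<otimes> star A b)"
    and q: "0 \<le> q" "q < 1"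
  shows "cnorm A b \<le> 1" and "cnorm A (T \<ominus> b \<otimes> star A b) \<le> 1"
proof -
  note [simp] = T(1) b(1) star_closed
  \<comment> \<open>With \<open>t\<close> the square of the norm of \<open>b\<close>, the
    C*-identity turns the relation into \<open>t \<le> (1 - q) + q t\<close>.\<close>
  have "(cnorm A b)\<^sup>2 \<le> cnorm A (complex_of_real (1 - q) \<odot> T) + cnorm A (complex_of_real q \<odot> (b \<otimes> star A b))"
    using cnorm_add[of "complex_of_real (1 - q) \<odot> T" "complex_of_real q \<odot> (b \<otimes> star A b)"]
    by (simp add: cstar_identity[symmetric] rel)
  also have "\<dots> \<le> (1 - q) * 1 + q * (cnorm A b)\<^sup>2"
    using T(3) q cstar_identity[of "star A b"]
    by (intro add_mono) (auto simp: cnorm_smult star_star cnorm_star simp del: of_real_diff intro!: mult_left_mono)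
  finally have "(1 - q) * (cnorm A b)\<^sup>2 \<le> (1 - q) * 1"
    by (simp add: algebra_simps)
  hence "(cnorm A b)\<^sup>2 \<le> 1"
    using q by (simp add: mult_le_cancel_left)
  thus b_le: "cnorm A b \<le> 1"
    by (simp add: abs_square_le_1 cnorm_nonneg)
  define R where "R = T \<ominus> b \<otimes> star A b"
  have R [simp]: "R \<in> carrier A" by (simp add: R_def)
  have "star A R = R"
    by (simp add: R_def minus_eq_smult star_add star_smult star_mult star_star T(2))
  have "R \<otimes> b = b \<otimes> (T \<ominus> star A b \<otimes> b)"
    by (simp add: R_def minus_eq_smult l_distr r_distr m_assoc b(2) smult_mult_left smult_mult_right)
  also have "T \<ominus> star A b \<otimes> b = complex_of_real q \<odot> R"
  proof -
    have cancel: "(1 - complex_of_real q) \<odot> T \<oplus> ((complex_of_real q - 1) \<odot> T \<oplus> y) = y"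
      if "y \<in> carrier A" for y
      using that smult_add_left[of T "1 - complex_of_real q" "complex_of_real q - 1"]
      by (simp add: a_assoc[symmetric])
    have "T = complex_of_real q \<odot> T \<oplus> complex_of_real (1 - q) \<odot> T"
      using smult_add_left[of T "complex_of_real q" "complex_of_real (1 - q)"] by simp
    hence "T \<ominus> star A b \<otimes> b = complex_of_real q \<odot> T \<oplus> complex_of_real (1 - q) \<odot> T \<ominus> star A b \<otimes> b"
      by simp
    also have "\<dots> = complex_of_real q \<odot> R"
      unfolding rel R_def
      by (simp add: minus_eq minus_add a_assoc cancel smult_add_right smult_minus_one[symmetric] mult.commute)
    finally show ?thesis .
  qed
  finally have Rb: "R \<otimes> b = complex_of_real q \<odot> (b \<otimes> R)"
    by (simp add: smult_mult_right)
  have Rn_b: "R [^] n \<otimes> b = complex_of_real (q ^ n) \<odot> (b \<otimes> R [^] n)" for n :: nat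
  proof (induction n)
    case (Suc n)
    have "R [^] Suc n \<otimes> b = complex_of_real q \<odot> (R [^] n \<otimes> b \<otimes> R)"
      by (simp add: m_assoc Rb smult_mult_right)
    also have "\<dots> = complex_of_real (q ^ Suc n) \<odot> (b \<otimes> R [^] Suc n)"
      by (simp add: Suc smult_mult_left m_assoc)
    finally show ?case .
  qed simp
  have Suc_n: "R [^] Suc n = R [^] n \<otimes> T \<oplus> complex_of_real (- (q ^ n)) \<odot> (b \<otimes> R [^] n \<otimes> star A b)" for n :: nat
  proof -
    have "R [^] Suc n = R [^] n \<otimes> T \<oplus> (- 1) \<odot> (R [^] n \<otimes> b \<otimes> star A b)"
      by (simp add: R_def[symmetric]) (simp add: R_def minus_eq_smult r_distr m_assoc smult_mult_right)
    thus ?thesis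
      by (simp add: Rn_b smult_mult_left)
  qed
  \<comment> \<open>One more power multiplies the bound by \<open>1 + q^n \<le> exp (q^n)\<close>;
    summability of the exponents keeps all powers bounded.\<close>
  have Rn_le: "cnorm A (R [^] n) \<le> exp (\<Sum>k<n. q ^ k)" for n :: nat
  proof (induction n)
    case 0
    thus ?case by (simp add: cnorm_one_le)
  next
    case (Suc n)
    have "cnorm A (R [^] n \<otimes> T) \<le> cnorm A (R [^] n) * 1"
      using T(3) by (intro order_trans[OF cnorm_mult] mult_left_mono) (auto simp: cnorm_nonneg)
    moreover have "cnorm A (b \<otimes> R [^] n \<otimes> star A b) \<le> 1 * cnorm A (R [^] n) * 1"
      using b_le
      by (intro order_trans[OF cnorm_mult] mult_mono mult_nonneg_nonneg) (auto simp: cnorm_nonneg cnorm_star)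
    ultimately have "cnorm A (R [^] Suc n) \<le> cnorm A (R [^] n) + q ^ n * cnorm A (R [^] n)"
      unfolding Suc_n using q
      by (intro order_trans[OF cnorm_add] add_mono) (auto simp: cnorm_smult norm_power intro!: mult_left_mono)
    also have "\<dots> = (1 + q ^ n) * cnorm A (R [^] n)"
      by (simp add: algebra_simps)
    also have "\<dots> \<le> exp (q ^ n) * exp (\<Sum>k<n. q ^ k)"
      using Suc by (intro mult_mono exp_ge_add_one_self) (auto simp: cnorm_nonneg)
    finally show ?case
      by (simp add: exp_add mult.commute)
  qed
  have "cnorm A R \<le> 1"
  proof (rule le_of_powers_le_polynomial)
    fix k :: nat
    have "cnorm A R ^ (2 ^ k) \<le> exp (1 / (1 - q))"
      using Rn_le[of "2 ^ k"] sum_power_le[OF q, of "2 ^ k"] \<open>star A R = R\<close>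
      by (simp add: cnorm_self_adjoint_pow[symmetric] order_trans)
    thus "cnorm A R ^ (2 ^ k) \<le> exp (1 / (1 - q)) * real (2 ^ k) ^ 0 * 1 ^ (2 ^ k)"
      by simp
  qed simp
  thus "cnorm A (T \<ominus> b \<otimes> star A b) \<le> 1"
    by (simp add: R_def)
qed

end

section \<open>Contractivity of representations\<close>

lemma adjoint_norm_le:
  fixes T T' :: "'h :: complex_hilbert_space \<Rightarrow> 'h"
  assumes adj: "\<And>u w. cinner (T u) w = cinner u (T' w)"
    and T_le: "\<And>u. norm (T u) \<le> \<beta> * norm u" and "0 \<le> \<beta>"
  shows "norm (T' w) \<le> \<beta> * norm w"
proof (cases "T' w = 0")
  case False
  have "norm (T' w) * norm (T' w) = cmod (cinner (T (T' w)) w)"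
    by (simp add: adj cinner_self power2_eq_square norm_mult)
  also have "\<dots> \<le> norm (T (T' w)) * norm w"
    by (rule cinner_Cauchy_Schwarz)
  also have "\<dots> \<le> \<beta> * norm (T' w) * norm w"
    by (intro mult_right_mono T_le) auto
  finally show ?thesis
    using False by (simp add: mult_ac)
qed (simp add: \<open>0 \<le> \<beta>\<close>)

text \<open>If the operator norm \<open>N\<close> of \<open>T = \<pi> x\<close> exceeded
  \<open>cnorm A x\<close>, then \<open>h = x^* x / N^2\<close> would have norm below 1, and a left
  inverse \<open>g\<close> of \<open>1 - h\<close> would bound \<open>1 - \<pi> h\<close> below by
  \<open>1 / G\<close>. But the square of the norm of \<open>u - \<pi> h u\<close> is at most
  \<open>|u|^2 - |T u|^2 / N^2\<close>, so \<open>|T u|^2 \<le> N^2 (1 - 1 / G^2) |u|^2\<close>,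
  which contradicts the choice of \<open>N\<close>.\<close>

lemma representation_norm_le:
  fixes A :: "'a star_algebra" and \<pi> :: "'a \<Rightarrow> 'h \<Rightarrow> 'h :: complex_hilbert_space"
  assumes "cstar_algebra A" and rep: "representation A \<pi>" and x: "x \<in> carrier A"
  shows "norm (\<pi> x v) \<le> cnorm A x * norm v"
proof -
  interpret cstar_algebra A by fact
  have lin: "bounded_linear (\<pi> y)" if "y \<in> carrier A" for y
    using rep that by (auto simp: representation_def bounded_clinear_def)
  define T where "T = \<pi> x"
  define T' where "T' = \<pi> (star A x)"
  define N where "N = onorm T"
  have T: "bounded_linear T" using lin x by (simp add: T_def)
  have T_le: "norm (T u) \<le> N * norm u" for u
    unfolding N_def by (rule onorm[OF T])
  have N0: "0 \<le> N" unfolding N_def by (rule onorm_pos_le[OF T])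
  have adj: "cinner (T u) w = cinner u (T' w)" for u w
    using rep x by (auto simp: representation_def T_def T'_def)
  have T'_le: "norm (T' w) \<le> N * norm w" for w
    using adj T_le N0 by (rule adjoint_norm_le)
  have "N \<le> cnorm A x"
  proof (rule ccontr)
    assume "\<not> N \<le> cnorm A x"
    hence less: "cnorm A x < N" by simp
    hence N: "0 < N" using cnorm_nonneg[OF x] by linarith
    define h where "h = complex_of_real (1 / N\<^sup>2) \<odot>\<^bsub>A\<^esub> (star A x \<otimes>\<^bsub>A\<^esub> x)"
    have h: "h \<in> carrier A" using x by (simp add: h_def star_closed)
    have "(cnorm A x)\<^sup>2 < N\<^sup>2"
      using less cnorm_nonneg[OF x] by (simp add: power_strict_mono)
    hence "cnorm A h < 1"
      unfolding h_def using x N by (simp add: cnorm_smult cstar_identity star_closed norm_divide norm_power)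
    then obtain g where g: "g \<in> carrier A" "\<one>\<^bsub>A\<^esub> \<oplus>\<^bsub>A\<^esub> g \<otimes>\<^bsub>A\<^esub> h = g"
      using left_inverse_one_minus h by blast
    \<comment> \<open>Enlarging the bound of \<open>\<pi> g\<close> to at least 1 keeps
      \<open>1 - 1 / G^2\<close> nonnegative under the square root.\<close>
    obtain G where G: "\<And>u. norm (\<pi> g u) \<le> norm u * G" and "1 \<le> G"
      using bounded_linear.bounded[OF lin[OF g(1)]]
      by (metis max.cobounded1 max.cobounded2 mult_left_mono norm_ge_zero order_trans)
    have \<pi>h: "\<pi> h u = complex_of_real (1 / N\<^sup>2) *\<^sub>C T' (T u)" for u
      using rep x by (simp add: representation_def h_def star_closed T_def T'_def)
    have "norm (T u) \<le> sqrt (N\<^sup>2 * (1 - 1 / G\<^sup>2)) * norm u" for u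
    proof -
      have "\<pi> (\<one>\<^bsub>A\<^esub> \<oplus>\<^bsub>A\<^esub> g \<otimes>\<^bsub>A\<^esub> h) u = u + \<pi> g (\<pi> h u)"
        using rep g(1) h by (simp add: representation_def)
      hence "u = \<pi> g (u - \<pi> h u)"
        by (simp add: g(2) linear_diff[OF bounded_linear.linear[OF lin[OF g(1)]]])
      hence "norm u \<le> norm (u - \<pi> h u) * G"
        using G[of "u - \<pi> h u"] by simp
      hence "(norm u)\<^sup>2 \<le> (norm (u - \<pi> h u))\<^sup>2 * G\<^sup>2"
        by (metis norm_ge_zero power_mono power_mult_distrib)
      hence 1: "(norm u)\<^sup>2 / G\<^sup>2 \<le> (norm (u - \<pi> h u))\<^sup>2"
        using \<open>1 \<le> G\<close> by (simp add: divide_le_eq)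
      have "u - \<pi> h u = u + complex_of_real (- (1 / N\<^sup>2)) *\<^sub>C T' (T u)"
        unfolding \<pi>h using scaleC_of_real[of "1 / N\<^sup>2" "T' (T u)"] scaleC_of_real[of "- (1 / N\<^sup>2)" "T' (T u)"]
        by simp
      hence expand: "(norm (u - \<pi> h u))\<^sup>2 = (norm u)\<^sup>2 - 2 * ((norm (T u))\<^sup>2 / N\<^sup>2) +
          (norm (T' (T u)))\<^sup>2 / (N\<^sup>2)\<^sup>2"
        by (simp only: norm_add_sq cinner_scaleC_right norm_scaleC power_mult_distrib adj[symmetric]
            cinner_self) (simp add: norm_divide norm_power power_divide)
      have "(norm (T' (T u)))\<^sup>2 \<le> N\<^sup>2 * (norm (T u))\<^sup>2"
        using T'_le[of "T u"] by (metis norm_ge_zero power_mono power_mult_distrib)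
      hence "(norm (T' (T u)))\<^sup>2 / (N\<^sup>2)\<^sup>2 \<le> N\<^sup>2 * (norm (T u))\<^sup>2 / (N\<^sup>2)\<^sup>2"
        by (rule divide_right_mono) simp
      also have "\<dots> = (norm (T u))\<^sup>2 / N\<^sup>2"
        unfolding power2_eq_square[of "N\<^sup>2"] mult_divide_mult_cancel_left_if using N by simp
      finally have "(norm (T' (T u)))\<^sup>2 / (N\<^sup>2)\<^sup>2 \<le> (norm (T u))\<^sup>2 / N\<^sup>2" .
      hence "(norm (u - \<pi> h u))\<^sup>2 \<le> (norm u)\<^sup>2 - (norm (T u))\<^sup>2 / N\<^sup>2"
        unfolding expand by linarith
      hence "(norm u)\<^sup>2 / G\<^sup>2 \<le> (norm u)\<^sup>2 - (norm (T u))\<^sup>2 / N\<^sup>2"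
        using 1 by linarith
      hence "(norm (T u))\<^sup>2 / N\<^sup>2 \<le> (1 - 1 / G\<^sup>2) * (norm u)\<^sup>2"
        by (simp add: algebra_simps)
      hence "(norm (T u))\<^sup>2 \<le> N\<^sup>2 * (1 - 1 / G\<^sup>2) * (norm u)\<^sup>2"
        using N by (simp add: divide_le_eq mult_ac)
      hence "sqrt ((norm (T u))\<^sup>2) \<le> sqrt (N\<^sup>2 * (1 - 1 / G\<^sup>2) * (norm u)\<^sup>2)"
        by (rule real_sqrt_le_mono)
      thus ?thesis
        by (simp add: real_sqrt_mult)
    qed
    hence "onorm T \<le> sqrt (N\<^sup>2 * (1 - 1 / G\<^sup>2))"
      using \<open>1 \<le> G\<close> by (intro onorm_bound) (auto simp: divide_le_eq)
    hence "N \<le> sqrt (N\<^sup>2 * (1 - 1 / G\<^sup>2))"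
      by (simp add: N_def)
    also have "\<dots> < sqrt (N\<^sup>2 * 1)"
      using N \<open>1 \<le> G\<close> by (intro real_sqrt_less_mono mult_strict_left_mono) auto
    finally show False using N by simp
  qed
  thus ?thesis
    using T_le[of v] mult_right_mono[of N "cnorm A x" "norm v"] by (simp add: T_def)
qed

section \<open>Wick ordering\<close>

locale twisted_ccr_algebra = cstar_algebra A for A :: "'a star_algebra" (structure) +
  fixes d :: nat and \<mu> :: real and a :: "nat \<Rightarrow> 'a"
  assumes \<mu>: "\<bar>\<mu>\<bar> < 1" and ccr: "twisted_ccr d \<mu> A a"
begin

lemmas [simp] = star_closed

text \<open>The normalisation makes the generators contractive.\<close>

definition gen :: "nat \<Rightarrow> 'a"
  where "gen i = complex_of_real (sqrt (1 - \<mu>\<^sup>2)) \<odot> a i"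

text \<open>Each step is the passage from \<open>T\<close> to \<open>T - b b^*\<close> in
  \<open>contractive_q_relation\<close>, so a single induction bounds all residuals and with them
  the generators.\<close>

primrec residual :: "nat \<Rightarrow> 'a" where
  "residual 0 = \<one>"
| "residual (Suc i) = residual i \<ominus> gen (Suc i) \<otimes> star A (gen (Suc i))"

definition word :: "nat list \<Rightarrow> 'a"
  where "word u = foldr (\<lambda>i x. gen i \<otimes> x) u \<one>"

fun ordered_word :: "nat \<Rightarrow> nat list \<Rightarrow> 'a" where
  "ordered_word i [] = \<one>"
| "ordered_word i (r # rs) = gen i [^] r \<otimes> ordered_word (Suc i) rs"

section \<open>Relations and norm bounds for the normalised generators\<close>

lemma q_bounds: "0 \<le> \<mu>\<^sup>2" "\<mu>\<^sup>2 < 1"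
  using \<mu> by (auto simp: abs_square_less_1)

lemma sqrt_mult_self: "complex_of_real (sqrt (1 - \<mu>\<^sup>2)) * complex_of_real (sqrt (1 - \<mu>\<^sup>2)) =
    complex_of_real (1 - \<mu>\<^sup>2)"
  using q_bounds by (simp only: of_real_mult[symmetric]) simp

lemma a_closed_gen [simp]: "i \<in> {1..d} \<Longrightarrow> a i \<in> carrier A"
  using ccr by (simp add: twisted_ccr_def)

lemma gen_closed [simp]: "i \<in> {1..d} \<Longrightarrow> gen i \<in> carrier A"
  by (simp add: gen_def del: atLeastAtMost_iff)

lemma star_gen: "i \<in> {1..d} \<Longrightarrow> star A (gen i) = complex_of_real (sqrt (1 - \<mu>\<^sup>2)) \<odot> star A (a i)"
  by (simp add: gen_def star_smult del: atLeastAtMost_iff)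

lemma gen_mult_star_gen:
  "i \<in> {1..d} \<Longrightarrow> gen i \<otimes> star A (gen i) = complex_of_real (1 - \<mu>\<^sup>2) \<odot> (a i \<otimes> star A (a i))"
  unfolding star_gen
  by (simp add: gen_def smult_mult_left smult_mult_right sqrt_mult_self del: atLeastAtMost_iff of_real_diff)

lemma star_gen_mult_gen_neq:
  assumes i: "i \<in> {1..d}" and j: "j \<in> {1..d}" and "i \<noteq> j"
  shows "star A (gen i) \<otimes> gen j = complex_of_real \<mu> \<odot> (gen j \<otimes> star A (gen i))"
proof -
  have "star A (a i) \<otimes> a j = complex_of_real \<mu> \<odot> (a j \<otimes> star A (a i))"
    using ccr assms by (simp add: twisted_ccr_def)
  thus ?thesis
    unfolding star_gen[OF i] using i j
    by (simp add: gen_def smult_mult_left smult_mult_right mult_ac del: atLeastAtMost_iff)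
qed

lemma gen_mult_gen:
  assumes i: "i \<in> {1..d}" and j: "j \<in> {1..d}" and "i < j"
  shows "gen j \<otimes> gen i = complex_of_real \<mu> \<odot> (gen i \<otimes> gen j)"
proof -
  have "a j \<otimes> a i = complex_of_real \<mu> \<odot> (a i \<otimes> a j)"
    using ccr assms by (simp add: twisted_ccr_def)
  thus ?thesis
    using i j by (simp add: gen_def smult_mult_left smult_mult_right mult_ac del: atLeastAtMost_iff)
qed

lemma residual_closed [simp]: "i \<le> d \<Longrightarrow> residual i \<in> carrier A"
  by (induction i) auto

lemma residual_eq:
  "i \<le> d \<Longrightarrow> residual i =
    \<one> \<ominus> complex_of_real (1 - \<mu>\<^sup>2) \<odot> (\<Oplus>k\<in>{1..<Suc i}. a k \<otimes> star A (a k))"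
proof (induction i)
  case 0
  thus ?case by (simp add: minus_eq)
next
  case (Suc i)
  have "Suc i \<in> {1..d}" using Suc by simp
  have fin: "(\<Oplus>k\<in>{1..<Suc i}. a k \<otimes> star A (a k)) \<in> carrier A"
    using Suc by (intro finsum_closed) auto
  have "(\<Oplus>k\<in>{1..<Suc (Suc i)}. a k \<otimes> star A (a k)) =
      a (Suc i) \<otimes> star A (a (Suc i)) \<oplus> (\<Oplus>k\<in>{1..<Suc i}. a k \<otimes> star A (a k))"
    using Suc finsum_insert[of "{1..<Suc i}" "Suc i" "\<lambda>k. a k \<otimes> star A (a k)"]
    by (simp add: atLeastLessThanSuc Pi_iff)
  thus ?case
    using Suc fin gen_mult_star_gen[OF \<open>Suc i \<in> {1..d}\<close>]
    by (simp add: minus_eq_smult smult_add_right a_ac del: of_real_diff)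
qed

lemma star_gen_mult_gen:
  assumes "Suc i \<in> {1..d}"
  shows "star A (gen (Suc i)) \<otimes> gen (Suc i) = complex_of_real (1 - \<mu>\<^sup>2) \<odot> residual i \<oplus>
    complex_of_real (\<mu>\<^sup>2) \<odot> (gen (Suc i) \<otimes> star A (gen (Suc i)))"
proof -
  define F where "F = (\<Oplus>k\<in>{1..<Suc i}. a k \<otimes> star A (a k))"
  have F: "F \<in> carrier A"
    unfolding F_def using assms by (intro finsum_closed) auto
  have x: "a (Suc i) \<in> carrier A" using assms by simp
  have "star A (gen (Suc i)) \<otimes> gen (Suc i) = complex_of_real (1 - \<mu>\<^sup>2) \<odot> (star A (a (Suc i)) \<otimes> a (Suc i))"
    unfolding star_gen[OF assms] using x
    by (simp add: gen_def smult_mult_left smult_mult_right sqrt_mult_self del: of_real_diff)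
  also have "star A (a (Suc i)) \<otimes> a (Suc i) =
      \<one> \<oplus> complex_of_real (\<mu>\<^sup>2) \<odot> (a (Suc i) \<otimes> star A (a (Suc i))) \<ominus> complex_of_real (1 - \<mu>\<^sup>2) \<odot> F"
    using ccr assms unfolding twisted_ccr_def F_def by blast
  also have "complex_of_real (1 - \<mu>\<^sup>2) \<odot> \<dots> = complex_of_real (1 - \<mu>\<^sup>2) \<odot> (\<one> \<ominus> complex_of_real (1 - \<mu>\<^sup>2) \<odot> F) \<oplus>
    complex_of_real (\<mu>\<^sup>2) \<odot> (complex_of_real (1 - \<mu>\<^sup>2) \<odot> (a (Suc i) \<otimes> star A (a (Suc i))))"
    using x F by (simp add: minus_eq_smult smult_add_right a_ac mult_ac del: of_real_diff)
  finally show ?thesis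
    using assms by (simp only: gen_mult_star_gen[OF assms] residual_eq F_def) (simp add: residual_eq F_def)
qed

text \<open>For \<open>k < j\<close> both relations carry the same factor:
  \<open>b_k b_k^* b_j = \<mu> b_k b_j b_k^* = b_j b_k b_k^*\<close>. Nothing is divided by
  \<open>\<mu>\<close>, so \<open>\<mu> = 0\<close> is covered.\<close>

lemma residual_gen_commute:
  assumes "i < j" and j: "j \<in> {1..d}"
  shows "residual i \<otimes> gen j = gen j \<otimes> residual i"
  using \<open>i < j\<close>
proof (induction i)
  case 0
  thus ?case using j by simp
next
  case (Suc i)
  have i: "Suc i \<in> {1..d}" using Suc.prems j by simp
  note [simp] = gen_closed[OF i] gen_closed[OF j]
  have "gen (Suc i) \<otimes> star A (gen (Suc i)) \<otimes> gen j =
      complex_of_real \<mu> \<odot> (gen (Suc i) \<otimes> gen j \<otimes> star A (gen (Suc i)))"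
    using Suc.prems by (simp add: m_assoc star_gen_mult_gen_neq[OF i j] smult_mult_right)
  also have "\<dots> = gen j \<otimes> gen (Suc i) \<otimes> star A (gen (Suc i))"
    by (simp add: gen_mult_gen[OF i j Suc.prems] smult_mult_left)
  finally show ?case
    using Suc i by (simp add: minus_eq l_distr r_distr l_minus r_minus m_assoc)
qed

lemma star_residual: "i \<le> d \<Longrightarrow> star A (residual i) = residual i"
  by (induction i) (auto simp: minus_eq_smult star_add star_smult star_mult star_star)

lemma cnorm_residual_le: "i \<le> d \<Longrightarrow> cnorm A (residual i) \<le> 1"
proof (induction i)
  case 0
  thus ?case by (simp add: cnorm_one_le)
next
  case (Suc i)
  hence "Suc i \<in> {1..d}" by simp
  thus ?case
    using Suc contractive_q_relation(2)[OF _ _ _ _ _ star_gen_mult_gen, of i]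
    by (simp add: star_residual residual_gen_commute q_bounds)
qed

lemma cnorm_gen_le:
  assumes "i \<in> {1..d}"
  shows "cnorm A (gen i) \<le> 1"
proof -
  obtain j where j: "i = Suc j"
    using assms by (cases i) auto
  thus ?thesis
    using assms contractive_q_relation(1)[OF _ _ _ _ _ star_gen_mult_gen, of j]
    by (simp add: star_residual residual_gen_commute q_bounds cnorm_residual_le)
qed

section \<open>The filtration by Wick-ordered words\<close>

lemma word_Nil [simp]: "word [] = \<one>"
  by (simp add: word_def)

lemma word_Cons [simp]: "word (i # u) = gen i \<otimes> word u"
  by (simp add: word_def)

lemma word_closed [simp]: "set u \<subseteq> {1..d} \<Longrightarrow> word u \<in> carrier A"
  by (induction u) auto

lemma word_append: "set u \<subseteq> {1..d} \<Longrightarrow> set v \<subseteq> {1..d} \<Longrightarrow> word (u @ v) = word u \<otimes> word v"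
  by (induction u) (auto simp: m_assoc)

text \<open>\<open>D\<close> tracks the degree, which must grow only linearly under powers. Words
  are left unsorted: sorting changes them by scalars and is postponed to the normal form.\<close>

inductive_set wick_span :: "nat \<Rightarrow> 'a set" for D :: nat where
  zero: "\<zero> \<in> wick_span D"
| word: "\<lbrakk>set u \<subseteq> {1..d}; set v \<subseteq> {1..d}; length u + length v \<le> D\<rbrakk> \<Longrightarrow>
    word u \<otimes> star A (word v) \<in> wick_span D"
| add: "\<lbrakk>x \<in> wick_span D; y \<in> wick_span D\<rbrakk> \<Longrightarrow> x \<oplus> y \<in> wick_span D"
| smult: "x \<in> wick_span D \<Longrightarrow> c \<odot> x \<in> wick_span D"

lemma wick_span_closed [simp]: "x \<in> wick_span D \<Longrightarrow> x \<in> carrier A"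
  by (induction rule: wick_span.induct) auto

lemma wick_span_mono: "x \<in> wick_span D \<Longrightarrow> D \<le> E \<Longrightarrow> x \<in> wick_span E"
  by (induction rule: wick_span.induct) (auto simp del: One_nat_def intro: wick_span.intros)

lemma wick_span_minus: "x \<in> wick_span D \<Longrightarrow> y \<in> wick_span D \<Longrightarrow> x \<ominus> y \<in> wick_span D"
  by (simp add: minus_eq_smult wick_span.add wick_span.smult)

lemma one_in_wick_span: "\<one> \<in> wick_span D"
  using wick_span.word[of "[]" "[]"] by simp

lemma wick_span_star: "x \<in> wick_span D \<Longrightarrow> star A x \<in> wick_span D"
  by (induction rule: wick_span.induct)
     (auto simp: star_add star_smult star_mult star_star add.commute simp del: One_nat_def
       intro: wick_span.intros)

lemma gen_mult_wick_span:
  assumes "x \<in> wick_span D" and i: "i \<in> {1..d}"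
  shows "gen i \<otimes> x \<in> wick_span (Suc D)"
  using assms(1)
proof (induction rule: wick_span.induct)
  case (word u v)
  have "word (i # u) \<otimes> star A (word v) \<in> wick_span (Suc D)"
    using word i by (intro wick_span.word) auto
  thus ?case using word i by (simp add: m_assoc)
qed (use i in \<open>auto simp: r_distr smult_mult_right intro: wick_span.intros\<close>)

text \<open>The one place where Wick ordering uses the relations. If \<open>i = j\<close>, a
  residual appears; expanding it creates products \<open>gen k (gen k^* x)\<close> with other
  indices \<open>k\<close>, so the induction keeps \<open>i\<close> arbitrary. They have degree at
  most two above that of \<open>x\<close>, which is what the removed \<open>gen j\<close> and the
  adjoint allow.\<close>

lemma star_gen_mult_word:
  assumes "i \<in> {1..d}" "set u \<subseteq> {1..d}" "set v \<subseteq> {1..d}"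
  shows "star A (gen i) \<otimes> (word u \<otimes> star A (word v)) \<in> wick_span (Suc (length u + length v))"
  using assms
proof (induction u arbitrary: i)
  case Nil
  have "word [] \<otimes> star A (word (v @ [i])) \<in> wick_span (Suc (length v))"
    using Nil by (intro wick_span.word) auto
  thus ?case using Nil by (simp add: word_append star_mult)
next
  case (Cons j u)
  let ?n = "length u + length v"
  define x where "x = word u \<otimes> star A (word v)"
  have j: "j \<in> {1..d}" using Cons.prems by simp
  have x [simp]: "x \<in> carrier A" using Cons.prems by (simp add: x_def)
  have x_span: "x \<in> wick_span ?n"
    unfolding x_def using Cons.prems by (intro wick_span.word) auto
  have star_x: "star A (gen k) \<otimes> x \<in> wick_span (Suc ?n)" if "k \<in> {1..d}" for k
    unfolding x_def using Cons that by auto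
  have gen_star_x: "gen k \<otimes> (star A (gen k) \<otimes> x) \<in> wick_span (Suc (Suc ?n))" if "k \<in> {1..d}" for k
    using that star_x by (intro gen_mult_wick_span) auto
  have residual_x: "residual k \<otimes> x \<in> wick_span (Suc (Suc ?n))" if "k \<le> d" for k
    using that
  proof (induction k)
    case 0
    thus ?case using wick_span_mono[OF x_span] by simp
  next
    case (Suc k)
    have "Suc k \<in> {1..d}" using Suc.prems by simp
    thus ?case
      using Suc gen_star_x[of "Suc k"] wick_span_minus[of "residual k \<otimes> x" "Suc (Suc ?n)"]
      by (simp add: minus_eq l_distr l_minus m_assoc)
  qed
  have eq: "star A (gen i) \<otimes> (word (j # u) \<otimes> star A (word v)) = star A (gen i) \<otimes> gen j \<otimes> x"
    using Cons.prems by (simp add: x_def m_assoc)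
  show ?case
  proof (cases "i = j")
    case False
    have "star A (gen i) \<otimes> gen j \<otimes> x = complex_of_real \<mu> \<odot> (gen j \<otimes> (star A (gen i) \<otimes> x))"
      using Cons.prems j by (simp add: star_gen_mult_gen_neq[OF Cons.prems(1) j False] smult_mult_left m_assoc)
    thus ?thesis
      unfolding eq using star_x[OF Cons.prems(1)] gen_mult_wick_span[OF _ j] by (auto intro: wick_span.smult)
  next
    case True
    obtain k where k: "i = Suc k" using j True by (cases i) auto
    hence "Suc k \<in> {1..d}" using j True by simp
    hence "star A (gen i) \<otimes> gen j \<otimes> x = complex_of_real (1 - \<mu>\<^sup>2) \<odot> (residual k \<otimes> x) \<oplus>
        complex_of_real (\<mu>\<^sup>2) \<odot> (gen i \<otimes> (star A (gen i) \<otimes> x))"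
      using star_gen_mult_gen[of k] by (simp add: k True[symmetric] l_distr smult_mult_left m_assoc)
    thus ?thesis
      unfolding eq using residual_x[of k] gen_star_x[of i] Cons.prems k
      by (auto intro: wick_span.smult wick_span.add)
  qed
qed

lemma star_gen_mult_wick_span:
  assumes "x \<in> wick_span D" and i: "i \<in> {1..d}"
  shows "star A (gen i) \<otimes> x \<in> wick_span (Suc D)"
  using assms(1)
proof (induction rule: wick_span.induct)
  case (word u v)
  thus ?case
    using star_gen_mult_word[OF i, of u v] by (auto intro: wick_span_mono)
qed (use i in \<open>auto simp: r_distr smult_mult_right intro: wick_span.intros\<close>)

lemma word_mult_wick_span:
  "set u \<subseteq> {1..d} \<Longrightarrow> x \<in> wick_span D \<Longrightarrow> word u \<otimes> x \<in> wick_span (length u + D)"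
  by (induction u) (auto simp: m_assoc intro!: gen_mult_wick_span)

lemma star_word_mult_wick_span:
  "set u \<subseteq> {1..d} \<Longrightarrow> x \<in> wick_span D \<Longrightarrow> star A (word u) \<otimes> x \<in> wick_span (length u + D)"
proof (induction u arbitrary: x D)
  case (Cons i u)
  hence "star A (word u) \<otimes> (star A (gen i) \<otimes> x) \<in> wick_span (length u + Suc D)"
    by (intro Cons.IH star_gen_mult_wick_span) auto
  thus ?case using Cons.prems by (simp add: star_mult m_assoc)
qed simp

lemma wick_span_mult:
  assumes "x \<in> wick_span D" and y: "y \<in> wick_span E"
  shows "x \<otimes> y \<in> wick_span (D + E)"
  using assms(1)
proof (induction rule: wick_span.induct)
  case (word u v)
  hence "word u \<otimes> (star A (word v) \<otimes> y) \<in> wick_span (length u + (length v + E))"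
    by (intro word_mult_wick_span star_word_mult_wick_span y)
  thus ?case
    using word y by (auto simp: m_assoc intro: wick_span_mono)
qed (use y in \<open>auto simp: l_distr smult_mult_left intro: wick_span.intros\<close>)

lemma wick_span_pow: "x \<in> wick_span D \<Longrightarrow> x [^] (n :: nat) \<in> wick_span (n * D)"
proof (induction n)
  case (Suc n)
  thus ?case using wick_span_mult[of "x [^] n" "n * D" x D] by (simp add: add.commute)
qed (simp add: one_in_wick_span)

section \<open>Ordered monomials and the Wick normal form\<close>

lemma ordered_word_closed [simp]: "1 \<le> i \<Longrightarrow> i + length rs \<le> Suc d \<Longrightarrow> ordered_word i rs \<in> carrier A"
  by (induction i rs rule: ordered_word.induct) auto

lemma cnorm_ordered_word_le: "1 \<le> i \<Longrightarrow> i + length rs \<le> Suc d \<Longrightarrow> cnorm A (ordered_word i rs) \<le> 1"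
  by (induction i rs rule: ordered_word.induct)
     (auto simp: cnorm_one_le intro!: cnorm_mult_le_one cnorm_pow_le_one cnorm_gen_le)

text \<open>Entering from the left, \<open>gen j\<close> passes only powers of \<open>gen i\<close>
  with \<open>i < j\<close>; this is the direction in which the relation can be used for every
  \<open>\<mu>\<close>, including 0.\<close>

lemma gen_mult_ordered_word:
  assumes "1 \<le> i" "i \<le> j" "j < i + length rs" "i + length rs \<le> Suc d"
  shows "\<exists>c. gen j \<otimes> ordered_word i rs = c \<odot> ordered_word i (rs[j - i := Suc (rs ! (j - i))])"
  using assms
proof (induction i rs rule: ordered_word.induct)
  case (2 i r rs)
  have i: "i \<in> {1..d}" and j: "j \<in> {1..d}"
    using 2 by auto
  note [simp] = gen_closed[OF i] gen_closed[OF j]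
  have rest: "ordered_word (Suc i) rs \<in> carrier A"
    using 2 by simp
  show ?case
  proof (cases "i = j")
    case True
    have "gen j \<otimes> ordered_word i (r # rs) = 1 \<odot> ordered_word i (Suc r # rs)"
      using rest nat_pow_Suc2[of "gen i" r] by (simp add: True m_assoc[symmetric])
    thus ?thesis using True by auto
  next
    case False
    hence "i < j" using 2 by simp
    have pow: "gen j \<otimes> gen i [^] n = complex_of_real (\<mu> ^ n) \<odot> (gen i [^] n \<otimes> gen j)" for n :: nat
    proof (induction n)
      case (Suc n)
      have "gen j \<otimes> gen i [^] Suc n = complex_of_real (\<mu> ^ n) \<odot> (gen i [^] n \<otimes> (gen j \<otimes> gen i))"
        by (simp add: m_assoc[symmetric] Suc smult_mult_left)
      thus ?case
        by (simp add: gen_mult_gen[OF i j \<open>i < j\<close>] smult_mult_right m_assoc mult.commute)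
    qed simp
    have "\<exists>c. gen j \<otimes> ordered_word (Suc i) rs = c \<odot> ordered_word (Suc i) (rs[j - Suc i := Suc (rs ! (j - Suc i))])"
      using 2 \<open>i < j\<close> by simp
    then obtain c where c: "gen j \<otimes> ordered_word (Suc i) rs = c \<odot> ordered_word (Suc i) (rs[j - Suc i := Suc (rs ! (j - Suc i))])"
      by blast
    have upd: "ordered_word (Suc i) (rs[j - Suc i := Suc (rs ! (j - Suc i))]) \<in> carrier A"
      using 2 by (intro ordered_word_closed) auto
    have "gen j \<otimes> ordered_word i (r # rs) = complex_of_real (\<mu> ^ r) \<odot> (gen i [^] r \<otimes> (gen j \<otimes> ordered_word (Suc i) rs))"
      using rest by (simp add: m_assoc[symmetric] pow smult_mult_left)
    also have "\<dots> = (complex_of_real (\<mu> ^ r) * c) \<odot>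
        ordered_word i (r # rs[j - Suc i := Suc (rs ! (j - Suc i))])"
      using upd by (simp add: c smult_mult_right)
    finally show ?thesis
      using \<open>i < j\<close> by (cases "j - i") (auto simp: Suc_diff_Suc[symmetric])
  qed
qed simp

text \<open>A box instead of the simplex of total degree \<open>D\<close>: the cardinality is
  explicit and still polynomial in \<open>D\<close>.\<close>

definition multi_indices :: "nat \<Rightarrow> nat list set"
  where "multi_indices D = {r. set r \<subseteq> {..D} \<and> length r = d}"

lemma finite_multi_indices: "finite (multi_indices D)"
  by (simp add: multi_indices_def finite_lists_length_eq)

lemma card_multi_indices: "card (multi_indices D) = Suc D ^ d"
  by (simp add: multi_indices_def card_lists_length_eq)

lemma multi_indices_mono: "r \<in> multi_indices D \<Longrightarrow> D \<le> E \<Longrightarrow> r \<in> multi_indices E"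
  by (auto simp: multi_indices_def)

lemma word_eq_ordered_word:
  "set u \<subseteq> {1..d} \<Longrightarrow> \<exists>c. \<exists>r\<in>multi_indices (length u). word u = c \<odot> ordered_word 1 r"
proof (induction u)
  case Nil
  have "ordered_word i (replicate n 0) = \<one>" for i n
    by (induction n arbitrary: i) auto
  hence "word [] = 1 \<odot> ordered_word 1 (replicate d 0)"
    by simp
  thus ?case
    by (intro exI[of _ 1] bexI[of _ "replicate d 0"]) (auto simp: multi_indices_def)
next
  case (Cons i u)
  then obtain c r where r: "r \<in> multi_indices (length u)" "word u = c \<odot> ordered_word 1 r"
    by auto
  have len: "length r = d" using r by (simp add: multi_indices_def)
  have i: "i \<in> {1..d}" using Cons.prems by simp
  let ?r = "r[i - 1 := Suc (r ! (i - 1))]"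
  obtain c' where c': "gen i \<otimes> ordered_word 1 r = c' \<odot> ordered_word 1 ?r"
    using gen_mult_ordered_word[of 1 i r] i len by auto
  have "word (i # u) = (c * c') \<odot> ordered_word 1 ?r"
    using i len by (simp add: r(2) smult_mult_right c' del: One_nat_def)
  moreover have "?r \<in> multi_indices (length (i # u))"
  proof -
    have "r ! (i - 1) \<in> set r" using len i by (intro nth_mem) auto
    thus ?thesis
      using r(1) set_update_subset_insert[of r "i - 1" "Suc (r ! (i - 1))"]
      by (fastforce simp: multi_indices_def)
  qed
  ultimately show ?case by blast
qed

definition wick_monomial :: "nat list \<times> nat list \<Rightarrow> 'a"
  where "wick_monomial p = ordered_word 1 (fst p) \<otimes> star A (ordered_word 1 (snd p))"

abbreviation "index_pairs D \<equiv> multi_indices D \<times> multi_indices D"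

lemma wick_monomial_closed: "p \<in> index_pairs D \<Longrightarrow> wick_monomial p \<in> carrier A"
  by (auto simp: wick_monomial_def multi_indices_def)

lemma cnorm_wick_monomial_le: "p \<in> index_pairs D \<Longrightarrow> cnorm A (wick_monomial p) \<le> 1"
  by (auto simp: wick_monomial_def multi_indices_def cnorm_star cnorm_ordered_word_le intro!: cnorm_mult_le_one)

text \<open>Existence alone is claimed; that \<open>x\<close> determines its coefficients emerges
  when \<open>coeff_functional\<close> recovers them from \<open>\<pi> x\<close>.\<close>

lemma wick_normal_form:
  assumes "x \<in> wick_span D"
  shows "\<exists>c. x = (\<Oplus>p\<in>index_pairs D. c p \<odot> wick_monomial p)"
  using assms
proof (induction rule: wick_span.induct)
  case zero
  have "(\<Oplus>p\<in>index_pairs D. 0 \<odot> wick_monomial p) = \<zero>"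
    by (intro add.finprod_one_eqI) (auto intro: smult_zero_left wick_monomial_closed)
  thus ?case by (intro exI[of _ "\<lambda>_. 0"]) simp
next
  case (word u v)
  obtain c r where r: "r \<in> multi_indices (length u)" "word u = c \<odot> ordered_word 1 r"
    using word_eq_ordered_word[of u] word by auto
  obtain c' s where s: "s \<in> multi_indices (length v)" "word v = c' \<odot> ordered_word 1 s"
    using word_eq_ordered_word[of v] word by auto
  have mem: "(r, s) \<in> index_pairs D"
    using r(1) s(1) word(3) by (auto elim: multi_indices_mono)
  have "word u \<otimes> star A (word v) = (c * cnj c') \<odot> wick_monomial (r, s)"
    using r s by (simp add: wick_monomial_def multi_indices_def star_smult smult_mult_left smult_mult_right
        mult.commute)
  also have "\<dots> = (\<Oplus>p\<in>index_pairs D. if (r, s) = p then (c * cnj c') \<odot> wick_monomial p else \<zero>)"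
    using mem by (intro add.finprod_singleton[symmetric]) (auto simp: finite_multi_indices wick_monomial_closed)
  also have "\<dots> = (\<Oplus>p\<in>index_pairs D. (if (r, s) = p then c * cnj c' else 0) \<odot> wick_monomial p)"
    by (intro finsum_cong') (auto simp: wick_monomial_closed)
  finally show ?case by (rule exI[of _ "\<lambda>p. if (r, s) = p then c * cnj c' else 0"])
next
  case (add x y)
  then obtain c c' where c: "x = (\<Oplus>p\<in>index_pairs D. c p \<odot> wick_monomial p)"
      "y = (\<Oplus>p\<in>index_pairs D. c' p \<odot> wick_monomial p)"
    by blast
  have "x \<oplus> y = (\<Oplus>p\<in>index_pairs D. c p \<odot> wick_monomial p \<oplus> c' p \<odot> wick_monomial p)"
    unfolding c by (intro finsum_addf[symmetric]) (auto simp: wick_monomial_closed)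
  also have "\<dots> = (\<Oplus>p\<in>index_pairs D. (c p + c' p) \<odot> wick_monomial p)"
    by (intro finsum_cong') (auto simp: wick_monomial_closed smult_add_left)
  finally show ?case by (intro exI[of _ "\<lambda>p. c p + c' p"])
next
  case (smult x b)
  then obtain c where c: "x = (\<Oplus>p\<in>index_pairs D. c p \<odot> wick_monomial p)"
    by blast
  have "b \<odot> (\<Oplus>p\<in>I. c p \<odot> wick_monomial p) = (\<Oplus>p\<in>I. (b * c p) \<odot> wick_monomial p)"
    if "finite I" "I \<subseteq> index_pairs D" for I
    using that
  proof (induction I rule: finite_induct)
    case (insert p I)
    have "(\<lambda>p. f p \<odot> wick_monomial p) \<in> I \<rightarrow> carrier A" "f p \<odot> wick_monomial p \<in> carrier A" for f
      using insert.prems by (auto intro!: smult_closed wick_monomial_closed[of _ D])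
    thus ?case
      using insert wick_monomial_closed[of p D]
      by (simp add: smult_add_right finsum_closed)
  qed simp
  from this[of "index_pairs D"] show ?case
    by (intro exI[of _ "\<lambda>p. b * c p"]) (simp add: c finite_multi_indices)
qed

end

section \<open>Faithfulness of the Fock representation\<close>

locale twisted_ccr_vacuum = twisted_ccr_algebra A d \<mu> a
  for A :: "'a star_algebra" (structure) and d :: nat and \<mu> :: real and a :: "nat \<Rightarrow> 'a" +
  fixes \<pi> :: "'a \<Rightarrow> 'h \<Rightarrow> 'h :: complex_hilbert_space" and \<Omega> :: 'h
  assumes rep: "representation A \<pi>" and norm_\<Omega>: "norm \<Omega> = 1"
    and star_\<Omega>: "i \<in> {1..d} \<Longrightarrow> \<pi> (star A (a i)) \<Omega> = 0"
begin

lemma \<pi>_add: "x \<in> carrier A \<Longrightarrow> y \<in> carrier A \<Longrightarrow> \<pi> (x \<oplus> y) v = \<pi> x v + \<pi> y v"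
  and \<pi>_mult: "x \<in> carrier A \<Longrightarrow> y \<in> carrier A \<Longrightarrow> \<pi> (x \<otimes> y) v = \<pi> x (\<pi> y v)"
  and \<pi>_smult: "x \<in> carrier A \<Longrightarrow> \<pi> (c \<odot> x) v = c *\<^sub>C \<pi> x v"
  and \<pi>_one: "\<pi> \<one> v = v"
  and \<pi>_star: "x \<in> carrier A \<Longrightarrow> cinner (\<pi> x u) v = cinner u (\<pi> (star A x) v)"
  and \<pi>_scaleC: "x \<in> carrier A \<Longrightarrow> \<pi> x (c *\<^sub>C v) = c *\<^sub>C \<pi> x v"
  using rep by (simp_all add: representation_def bounded_clinear_def)

lemma norm_\<pi>_le: "x \<in> carrier A \<Longrightarrow> norm (\<pi> x v) \<le> cnorm A x * norm v"
  by (rule representation_norm_le[OF cstar_algebra_axioms rep])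

lemma \<pi>_zero: "\<pi> \<zero> v = 0"
  using norm_\<pi>_le[of \<zero> v] by simp

lemma \<pi>_minus: "x \<in> carrier A \<Longrightarrow> y \<in> carrier A \<Longrightarrow> \<pi> (x \<ominus> y) v = \<pi> x v - \<pi> y v"
  using scaleC_of_real[of "- 1" "\<pi> y v"] by (simp add: minus_eq_smult \<pi>_add \<pi>_smult)

lemma \<pi>_residual:
  "i \<le> d \<Longrightarrow> (\<And>j. j \<in> {1..i} \<Longrightarrow> \<pi> (star A (gen j)) v = 0) \<Longrightarrow> \<pi> (residual i) v = v"
proof (induction i)
  case (Suc i)
  hence "Suc i \<in> {1..d}" by simp
  hence "gen (Suc i) \<in> carrier A" by (rule gen_closed)
  thus ?case
    using Suc \<pi>_scaleC[of "gen (Suc i)" 0 0]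
    by (simp add: \<pi>_minus \<pi>_mult)
qed (simp add: \<pi>_one)

sublocale fock_operators d \<mu> "\<lambda>i. \<pi> (gen i)" "\<lambda>i. \<pi> (star A (gen i))" \<Omega>
proof
  show "norm (\<pi> (gen i) x) \<le> norm x" if "i \<in> {1..d}" for i x
    using norm_\<pi>_le[OF gen_closed[OF that], of x] cnorm_gen_le[OF that]
      mult_right_mono[of "cnorm A (gen i)" 1 "norm x"] by simp
  show "\<pi> (star A (gen i)) (\<pi> (gen j) x) = complex_of_real \<mu> *\<^sub>C \<pi> (gen j) (\<pi> (star A (gen i)) x)"
    if i: "i \<in> {1..d}" and j: "j \<in> {1..d}" and "i \<noteq> j" for i j x
    using star_gen_mult_gen_neq[OF that] gen_closed[OF i] gen_closed[OF j]
    by (simp add: \<pi>_mult[symmetric] \<pi>_smult[symmetric])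
  show "\<pi> (star A (gen i)) (\<pi> (star A (gen j)) x) =
      complex_of_real \<mu> *\<^sub>C \<pi> (star A (gen j)) (\<pi> (star A (gen i)) x)"
    if i: "i \<in> {1..d}" and j: "j \<in> {1..d}" and "i < j" for i j x
    using arg_cong[OF gen_mult_gen[OF that], of "star A"] gen_closed[OF i] gen_closed[OF j]
    by (simp add: star_mult star_smult \<pi>_mult[symmetric] \<pi>_smult[symmetric])
  show "\<pi> (star A (gen i)) (\<pi> (gen i) x) =
      complex_of_real (1 - \<mu>\<^sup>2) *\<^sub>C x + complex_of_real (\<mu>\<^sup>2) *\<^sub>C \<pi> (gen i) (\<pi> (star A (gen i)) x)"
    if i: "i \<in> {1..d}" and *: "\<And>j. j \<in> {1..<i} \<Longrightarrow> \<pi> (star A (gen j)) x = 0" for i x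
  proof -
    obtain k where k: "i = Suc k" using i by (cases i) auto
    hence [simp]: "gen (Suc k) \<in> carrier A" and "k \<le> d"
      using gen_closed[OF i] i by auto
    have "\<pi> (residual k) x = x"
      using * k \<open>k \<le> d\<close> by (intro \<pi>_residual) auto
    hence "\<pi> (star A (gen i) \<otimes> gen i) x = complex_of_real (1 - \<mu>\<^sup>2) *\<^sub>C x +
        complex_of_real (\<mu>\<^sup>2) *\<^sub>C \<pi> (gen i) (\<pi> (star A (gen i)) x)"
      using star_gen_mult_gen[of k] i \<open>k \<le> d\<close> by (simp add: k \<pi>_add \<pi>_smult \<pi>_mult del: of_real_diff)
    thus ?thesis
      by (simp add: k \<pi>_mult)
  qed
  show "\<pi> (star A (gen i)) \<Omega> = 0" if "i \<in> {1..d}" for i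
    using that star_\<Omega>[OF that] by (simp add: star_gen \<pi>_smult del: atLeastAtMost_iff)
qed (auto simp: \<mu> norm_\<Omega> \<pi>_scaleC \<pi>_star)

lemma \<pi>_star_ordered_word:
  "1 \<le> i \<Longrightarrow> i + length rs \<le> Suc d \<Longrightarrow> \<pi> (star A (ordered_word i rs)) u = annih i rs u"
proof (induction i rs arbitrary: u rule: ordered_word.induct)
  case (2 i r rs)
  have [simp]: "gen i \<in> carrier A" "ordered_word (Suc i) rs \<in> carrier A"
    using 2 by auto
  have "\<pi> (star A (gen i) [^] r) u = (\<pi> (star A (gen i)) ^^ r) u"
    by (induction r arbitrary: u) (auto simp: \<pi>_one \<pi>_mult funpow_swap1)
  thus ?case
    using 2 by (simp add: star_mult star_pow \<pi>_mult)
qed (simp add: \<pi>_one)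

lemma \<pi>_wick_monomial:
  assumes "p \<in> index_pairs D"
  shows "cinner (\<pi> (wick_monomial p) u) v = cinner (annih 1 (snd p) u) (annih 1 (fst p) v)"
proof -
  have "fst p \<in> multi_indices D" "snd p \<in> multi_indices D"
    using assms by auto
  thus ?thesis
    by (simp add: wick_monomial_def multi_indices_def \<pi>_mult \<pi>_star \<pi>_star_ordered_word del: One_nat_def)
qed

lemma \<pi>_finsum:
  "finite I \<Longrightarrow> f \<in> I \<rightarrow> carrier A \<Longrightarrow> cinner (\<pi> (\<Oplus>p\<in>I. f p) u) v = (\<Sum>p\<in>I. cinner (\<pi> (f p) u) v)"
  by (induction I rule: finite_induct) (auto simp: \<pi>_zero \<pi>_add cinner_add_left Pi_iff)

definition growth_const :: real
  where "growth_const = exp (1 / (1 - \<mu>\<^sup>2)\<^sup>2) ^ 3"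

text \<open>The exponent \<open>3 * d\<close> is \<open>d\<close> from the bound on each coefficient
  plus \<open>2 * d\<close> from the number of index pairs; the monomials themselves have norm at
  most 1.\<close>

lemma cnorm_wick_span_le_polynomial:
  assumes x: "x \<in> wick_span D" and \<beta>: "\<And>v. norm (\<pi> x v) \<le> \<beta> * norm v" "0 \<le> \<beta>"
  shows "cnorm A x \<le> real (Suc D) ^ (3 * d) * growth_const ^ d * \<beta>"
proof -
  obtain c where c: "x = (\<Oplus>p\<in>index_pairs D. c p \<odot> wick_monomial p)"
    using wick_normal_form[OF x] by blast
  have closed: "(\<lambda>p. c p \<odot> wick_monomial p) \<in> index_pairs D \<rightarrow> carrier A"
    using wick_monomial_closed by blast
  have fin: "finite (index_pairs D)"
    by (simp add: finite_multi_indices)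
  have form: "cinner (\<pi> x u) v =
      (\<Sum>p\<in>index_pairs D. c p * cinner (annih 1 (snd p) u) (annih 1 (fst p) v))" for u v
    unfolding c \<pi>_finsum[OF fin closed]
    by (intro sum.cong refl) (simp only: \<pi>_smult wick_monomial_closed cinner_scaleC_left \<pi>_wick_monomial)
  have coeff: "cmod (c p) \<le> (real (Suc D) * growth_const) ^ d * \<beta>" if p: "p \<in> index_pairs D" for p
  proof -
    obtain r s where rs: "p = (r, s)" "length r = d" "length s = d" "set r \<subseteq> {..D}"
      using p by (auto simp: multi_indices_def)
    have "coeff_functional 1 r s (\<lambda>u v. cinner (\<pi> x u) v) =
        (\<Sum>p'\<in>index_pairs D. c p' *
          coeff_functional 1 r s (\<lambda>u v. cinner (annih 1 (snd p') u) (annih 1 (fst p') v)))"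
      unfolding form using rs by (intro coeff_functional_sum fin) auto
    also have "\<dots> = (\<Sum>p'\<in>index_pairs D. if p' = p then c p' else 0)"
    proof (intro sum.cong refl)
      fix p' assume "p' \<in> index_pairs D"
      hence "length (fst p') = d" "length (snd p') = d"
        by (auto simp: multi_indices_def)
      hence "coeff_functional 1 r s (\<lambda>u v. cinner (annih 1 (snd p') u) (annih 1 (fst p') v)) =
          (if fst p' = r \<and> snd p' = s then 1 else 0)"
        using rs by (intro coeff_functional_monomial) auto
      thus "c p' * coeff_functional 1 r s (\<lambda>u v. cinner (annih 1 (snd p') u) (annih 1 (fst p') v)) =
          (if p' = p then c p' else 0)"
        using rs by (auto simp: prod_eq_iff)
    qed
    also have "\<dots> = c p"
      using p fin by simp
    finally have "c p = coeff_functional 1 r s (\<lambda>u v. cinner (\<pi> x u) v)" ..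
    also have "cmod \<dots> \<le> (real (Suc D) * growth_const) ^ length r * \<beta>"
      unfolding growth_const_def
    proof (rule coeff_functional_bound)
      show "cmod (cinner (\<pi> x u) v) \<le> \<beta> * norm u * norm v" for u v
        using cinner_Cauchy_Schwarz[of "\<pi> x u" v] mult_right_mono[OF \<beta>(1)[of u], of "norm v"] by simp
    qed (use rs \<beta> in auto)
    finally show ?thesis by (simp add: rs)
  qed
  have "cnorm A x \<le> (\<Sum>p\<in>index_pairs D. cnorm A (c p \<odot> wick_monomial p))"
    unfolding c by (rule cnorm_finsum_le[OF fin closed])
  also have "\<dots> \<le> (\<Sum>p\<in>index_pairs D. (real (Suc D) * growth_const) ^ d * \<beta>)"
  proof (rule sum_mono)
    fix p assume p: "p \<in> index_pairs D"
    have "cnorm A (c p \<odot> wick_monomial p) \<le> cmod (c p) * 1"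
      using cnorm_wick_monomial_le[OF p] wick_monomial_closed[OF p]
      by (simp only: cnorm_smult) (intro mult_left_mono, auto)
    thus "cnorm A (c p \<odot> wick_monomial p) \<le> (real (Suc D) * growth_const) ^ d * \<beta>"
      using coeff[OF p] by simp
  qed
  also have "\<dots> = real (Suc D) ^ (3 * d) * growth_const ^ d * \<beta>"
    by (simp add: card_cartesian_product card_multi_indices power_mult_distrib power_mult[of _ 3]
        power3_eq_cube del: of_nat_Suc)
  finally show ?thesis .
qed

text \<open>Passing to \<open>h\<close> provides a self-adjoint element, for which norms of
  \<open>2^k\<close>-th powers are powers of the norm. The degree of \<open>h^N\<close> is at most
  \<open>2 D N\<close>, so the loss is a polynomial in \<open>N\<close> of fixed degree.\<close>

lemma cnorm_wick_span_le:
  assumes x: "x \<in> wick_span D" and \<beta>: "\<And>v. norm (\<pi> x v) \<le> \<beta> * norm v" "0 \<le> \<beta>"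
  shows "cnorm A x \<le> \<beta>"
proof -
  define h where "h = star A x \<otimes> x"
  have xc [simp]: "x \<in> carrier A" using x by simp
  hence h [simp]: "h \<in> carrier A" by (simp add: h_def)
  have "h \<in> wick_span (D + D)"
    unfolding h_def by (intro wick_span_mult wick_span_star x)
  have \<beta>': "norm (\<pi> (star A x) w) \<le> \<beta> * norm w" for w
    using \<pi>_star[OF xc] \<beta> by (rule adjoint_norm_le)
  have h_le: "norm (\<pi> (h [^] n) v) \<le> (\<beta>\<^sup>2) ^ n * norm v" for n :: nat and v
  proof (induction n arbitrary: v)
    case 0
    thus ?case by (simp add: \<pi>_one)
  next
    case (Suc n)
    have "norm (\<pi> (h [^] n) (\<pi> h v)) \<le> (\<beta>\<^sup>2) ^ n * norm (\<pi> h v)"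
      by (rule Suc)
    also have "\<dots> \<le> (\<beta>\<^sup>2) ^ n * (\<beta> * (\<beta> * norm v))"
      using \<beta>'[of "\<pi> x v"] mult_left_mono[OF \<beta>(1)[of v] \<beta>(2)]
      by (intro mult_left_mono) (auto simp: h_def \<pi>_mult)
    finally show ?case
      by (simp add: \<pi>_mult power2_eq_square mult_ac)
  qed
  have "cnorm A h \<le> \<beta>\<^sup>2"
  proof (rule le_of_powers_le_polynomial)
    fix k :: nat
    let ?N = "2 ^ k :: nat"
    have "cnorm A h ^ ?N = cnorm A (h [^] ?N)"
      by (simp add: cnorm_self_adjoint_pow h_def star_mult star_star)
    also have "\<dots> \<le> real (Suc (?N * (D + D))) ^ (3 * d) * growth_const ^ d * (\<beta>\<^sup>2) ^ ?N"
      using h_le by (intro cnorm_wick_span_le_polynomial wick_span_pow \<open>h \<in> wick_span (D + D)\<close>) auto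
    also have "\<dots> \<le> (real (Suc (D + D)) * real ?N) ^ (3 * d) * growth_const ^ d * (\<beta>\<^sup>2) ^ ?N"
    proof (intro mult_right_mono power_mono)
      \<comment> \<open>Since \<open>?N\<close> is at least 1, it can be factored out, leaving a
        constant that depends on \<open>D\<close> only.\<close>
      have "Suc (?N * (D + D)) \<le> Suc (D + D) * ?N" by simp
      thus "real (Suc (?N * (D + D))) \<le> real (Suc (D + D)) * real ?N"
        by (simp only: of_nat_mult[symmetric] of_nat_le_iff)
    qed (auto simp: growth_const_def)
    also have "\<dots> = (real (Suc (D + D)) ^ (3 * d) * growth_const ^ d) * real ?N ^ (3 * d) * (\<beta>\<^sup>2) ^ ?N"
      by (simp only: power_mult_distrib mult_ac)
    finally show "cnorm A h ^ ?N \<le>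
        (real (Suc (D + D)) ^ (3 * d) * growth_const ^ d) * real ?N ^ (3 * d) * (\<beta>\<^sup>2) ^ ?N" .
  qed simp
  hence "(cnorm A x)\<^sup>2 \<le> \<beta>\<^sup>2"
    by (simp add: h_def cstar_identity)
  thus ?thesis
    using \<beta>(2) by (rule power2_le_imp_le)
qed

section \<open>Density of the polynomials and injectivity\<close>

definition polynomials :: "'a set"
  where "polynomials = (\<Union>D. wick_span D)"

text \<open>The closure \<open>S\<close> of the polynomials is a closed star-subalgebra containing
  the generators, so generation forces it to be everything.\<close>

lemma polynomials_dense:
  assumes "cstar_generated_by A (a ` {1..d})" and x: "x \<in> carrier A" and "0 < e"
  obtains p where "p \<in> polynomials" "cnorm A (x \<ominus> p) < e"
proof -
  interpret M: Metric_space "carrier A" "norm_dist A"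
    by (rule Metric_space_norm_dist)
  define S where "S = M.mtopology closure_of polynomials"
  have poly_closed: "p \<in> carrier A" if "p \<in> polynomials" for p
    using that by (auto simp: polynomials_def)
  have S_iff: "x \<in> S \<longleftrightarrow> x \<in> carrier A \<and> (\<forall>e>0. \<exists>p\<in>polynomials. cnorm A (x \<ominus> p) < e)" for x
    unfolding S_def M.metric_closure_of
    using poly_closed by (auto simp: norm_dist_def M.in_mball)
  have S_closed: "x \<in> carrier A" if "x \<in> S" for x
    using that by (simp add: S_iff)
  have approx: "\<exists>p\<in>polynomials. cnorm A (x \<ominus> p) < e" if "x \<in> S" "0 < e" for x e
    using that by (simp add: S_iff)
  have poly_sub: "polynomials \<subseteq> S"
    unfolding S_def by (intro closure_of_subset) (auto simp: poly_closed)
  have poly_add: "p \<oplus> p' \<in> polynomials" and poly_mult: "p \<otimes> p' \<in> polynomials"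
    if pp: "p \<in> polynomials" "p' \<in> polynomials" for p p'
  proof -
    obtain D E where "p \<in> wick_span D" "p' \<in> wick_span E"
      using pp by (auto simp: polynomials_def)
    thus "p \<otimes> p' \<in> polynomials"
      by (auto simp: polynomials_def intro: wick_span_mult)
    have "p \<oplus> p' \<in> wick_span (D + E)"
      using \<open>p \<in> wick_span D\<close> \<open>p' \<in> wick_span E\<close> by (intro wick_span.add) (auto elim: wick_span_mono)
    thus "p \<oplus> p' \<in> polynomials"
      by (auto simp: polynomials_def)
  qed
  have poly_smult: "c \<odot> p \<in> polynomials" and poly_star: "star A p \<in> polynomials"
    if "p \<in> polynomials" for c p
    using that by (auto simp: polynomials_def intro: wick_span.smult wick_span_star)
  have S_add: "x \<oplus> y \<in> S" if xy: "x \<in> S" "y \<in> S" for x y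
    unfolding S_iff
  proof (intro conjI allI impI)
    fix e :: real assume "0 < e"
    obtain p p' where p: "p \<in> polynomials" "cnorm A (x \<ominus> p) < e / 2"
        and p': "p' \<in> polynomials" "cnorm A (y \<ominus> p') < e / 2"
      using approx[OF xy(1), of "e / 2"] approx[OF xy(2), of "e / 2"] \<open>0 < e\<close> by auto
    note [simp] = S_closed[OF xy(1)] S_closed[OF xy(2)] poly_closed[OF p(1)] poly_closed[OF p'(1)]
    have "(x \<oplus> y) \<ominus> (p \<oplus> p') = (x \<ominus> p) \<oplus> (y \<ominus> p')"
      by (simp add: minus_eq minus_add a_ac)
    hence "cnorm A ((x \<oplus> y) \<ominus> (p \<oplus> p')) < e"
      using cnorm_add[of "x \<ominus> p" "y \<ominus> p'"] p p' by simp
    thus "\<exists>p\<in>polynomials. cnorm A (x \<oplus> y \<ominus> p) < e"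
      using poly_add[OF p(1) p'(1)] by blast
  qed (use xy S_closed in auto)
  have S_smult: "c \<odot> x \<in> S" if xy: "x \<in> S" for c x
    unfolding S_iff
  proof (intro conjI allI impI)
    fix e :: real assume "0 < e"
    obtain p where p: "p \<in> polynomials" "cnorm A (x \<ominus> p) < e / (cmod c + 1)"
      using approx[OF xy, of "e / (cmod c + 1)"] \<open>0 < e\<close> by (auto simp: add_nonneg_pos)
    note [simp] = S_closed[OF xy] poly_closed[OF p(1)]
    have "c \<odot> x \<ominus> c \<odot> p = c \<odot> (x \<ominus> p)"
      by (simp add: minus_eq_smult smult_add_right)
    hence "cnorm A (c \<odot> x \<ominus> c \<odot> p) = cmod c * cnorm A (x \<ominus> p)"
      by (simp add: cnorm_smult)
    also have "\<dots> \<le> (cmod c + 1) * cnorm A (x \<ominus> p)"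
      by (intro mult_right_mono) (auto simp: cnorm_nonneg)
    also have "\<dots> < e"
      using p(2) by (simp add: less_divide_eq mult.commute add_nonneg_pos)
    finally show "\<exists>q\<in>polynomials. cnorm A (c \<odot> x \<ominus> q) < e"
      using poly_smult[OF p(1)] by blast
  qed (use xy S_closed in auto)
  have S_star: "star A x \<in> S" if xy: "x \<in> S" for x
    unfolding S_iff
  proof (intro conjI allI impI)
    fix e :: real assume "0 < e"
    obtain p where p: "p \<in> polynomials" "cnorm A (x \<ominus> p) < e"
      using approx[OF xy \<open>0 < e\<close>] by auto
    note [simp] = S_closed[OF xy] poly_closed[OF p(1)]
    have "star A x \<ominus> star A p = star A (x \<ominus> p)"
      by (simp add: minus_eq_smult star_add star_smult)
    hence "cnorm A (star A x \<ominus> star A p) < e"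
      using p(2) cnorm_star[of "x \<ominus> p"] by simp
    thus "\<exists>q\<in>polynomials. cnorm A (star A x \<ominus> q) < e"
      using poly_star[OF p(1)] by blast
  qed (use xy S_closed in auto)
  have S_mult: "x \<otimes> y \<in> S" if xy: "x \<in> S" "y \<in> S" for x y
    unfolding S_iff
  proof (intro conjI allI impI)
    fix e :: real assume "0 < e"
    \<comment> \<open>The splitting is \<open>x y - p p' = x (y - p') + (x - p) p'\<close>. First
      \<open>p'\<close> is chosen and then \<open>p\<close>, with a tolerance depending on
      \<open>p'\<close>; adding 1 to the norms avoids division by 0.\<close>
    define \<delta> where "\<delta> = e / 2 / (cnorm A x + 1)"
    note [simp] = S_closed[OF xy(1)] S_closed[OF xy(2)]
    have "0 < \<delta>"
      using \<open>0 < e\<close> cnorm_nonneg[of x] by (auto simp: \<delta>_def add_nonneg_pos)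
    then obtain p' where p': "p' \<in> polynomials" "cnorm A (y \<ominus> p') < \<delta>"
      using approx[OF xy(2)] by blast
    note [simp] = poly_closed[OF p'(1)]
    have "0 < e / 2 / (cnorm A p' + 1)"
      using \<open>0 < e\<close> cnorm_nonneg[of p'] by (auto simp: add_nonneg_pos)
    then obtain p where p: "p \<in> polynomials" "cnorm A (x \<ominus> p) < e / 2 / (cnorm A p' + 1)"
      using approx[OF xy(1)] by blast
    note [simp] = poly_closed[OF p(1)]
    have "x \<otimes> y \<ominus> p \<otimes> p' = x \<otimes> (y \<ominus> p') \<oplus> (x \<ominus> p) \<otimes> p'"
      by (simp add: minus_eq l_distr r_distr l_minus r_minus a_assoc r_neg1)
    hence "cnorm A (x \<otimes> y \<ominus> p \<otimes> p') \<le> cnorm A x * cnorm A (y \<ominus> p') + cnorm A (x \<ominus> p) * cnorm A p'"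
      using cnorm_add[of "x \<otimes> (y \<ominus> p')" "(x \<ominus> p) \<otimes> p'"] cnorm_mult[of x "y \<ominus> p'"]
        cnorm_mult[of "x \<ominus> p" p'] by simp
    also have "\<dots> \<le> (cnorm A x + 1) * cnorm A (y \<ominus> p') + cnorm A (x \<ominus> p) * (cnorm A p' + 1)"
      by (intro add_mono mult_right_mono mult_left_mono) (auto simp: cnorm_nonneg)
    finally have le: "cnorm A (x \<otimes> y \<ominus> p \<otimes> p') \<le>
        (cnorm A x + 1) * cnorm A (y \<ominus> p') + cnorm A (x \<ominus> p) * (cnorm A p' + 1)" .
    have pos: "0 < cnorm A x + 1" "0 < cnorm A p' + 1"
      using cnorm_nonneg[of x] cnorm_nonneg[of p'] by simp_all
    have "(cnorm A x + 1) * cnorm A (y \<ominus> p') < e / 2"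
      using p'(2) unfolding \<delta>_def pos_less_divide_eq[OF pos(1)] by (simp only: mult.commute)
    moreover have "cnorm A (x \<ominus> p) * (cnorm A p' + 1) < e / 2"
      using p(2) unfolding pos_less_divide_eq[OF pos(2)] .
    ultimately have "cnorm A (x \<otimes> y \<ominus> p \<otimes> p') < e"
      using le by linarith
    thus "\<exists>q\<in>polynomials. cnorm A (x \<otimes> y \<ominus> q) < e"
      using poly_mult[OF p(1) p'(1)] by blast
  qed (use xy S_closed in auto)
  have one: "\<one> \<in> S"
    using poly_sub one_in_wick_span by (auto simp: polynomials_def)
  have "subring S A"
  proof (rule subringI)
    show "\<ominus> x \<in> S" if "x \<in> S" for x
      using S_smult[OF that, of "- 1"] S_closed[OF that] by (simp add: smult_minus_one)
  qed (use S_closed one S_add S_mult in auto)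
  hence "closed_star_subalgebra A S"
    by (simp add: closed_star_subalgebra_def S_smult S_star) (simp add: S_def)
  moreover have "a ` {1..d} \<subseteq> S"
  proof
    fix y assume "y \<in> a ` {1..d}"
    then obtain i where i: "i \<in> {1..d}" "y = a i" by blast
    have "gen i \<in> wick_span 1"
      using gen_mult_wick_span[OF one_in_wick_span i(1), of 0] i(1) by simp
    moreover have "y = complex_of_real (1 / sqrt (1 - \<mu>\<^sup>2)) \<odot> gen i"
      using i q_bounds a_closed_gen[OF i(1)] by (simp add: gen_def)
    ultimately have "y \<in> wick_span 1"
      by (simp add: wick_span.smult)
    thus "y \<in> S"
      using poly_sub by (auto simp: polynomials_def)
  qed
  ultimately have "S = carrier A"
    using assms(1) by (auto simp: cstar_generated_by_def)
  thus thesis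
    using approx[of x e] x \<open>0 < e\<close> that by blast
qed

text \<open>For a polynomial \<open>p\<close> near \<open>x\<close>, \<open>\<pi> p\<close> equals
  \<open>- \<pi> (x - p)\<close> and so has norm at most that of \<open>x - p\<close>. The estimate
  on polynomials transfers this to \<open>p\<close> itself, and the norm of \<open>x\<close> is at
  most twice that of \<open>x - p\<close>.\<close>

lemma eq_zero_if_\<pi>_eq_zero:
  assumes gen: "cstar_generated_by A (a ` {1..d})"
    and x: "x \<in> carrier A" and zero: "\<And>v. \<pi> x v = 0"
  shows "x = \<zero>"
proof -
  have "cnorm A x \<le> 0 + e" if e: "0 < e" for e
  proof -
    obtain p where p: "p \<in> polynomials" "cnorm A (x \<ominus> p) < e / 2"
      by (rule polynomials_dense[OF gen x half_gt_zero[OF e]])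
    then obtain D where D: "p \<in> wick_span D"
      by (auto simp: polynomials_def)
    note [simp] = x wick_span_closed[OF D]
    have "cnorm A p \<le> cnorm A (x \<ominus> p)"
    proof (rule cnorm_wick_span_le[OF D])
      show "norm (\<pi> p v) \<le> cnorm A (x \<ominus> p) * norm v" for v
        using norm_\<pi>_le[of "x \<ominus> p" v] zero[of v] by (simp add: \<pi>_minus)
    qed (simp add: cnorm_nonneg)
    moreover have "x = (x \<ominus> p) \<oplus> p"
      by (simp add: minus_eq a_assoc l_neg)
    hence "cnorm A x \<le> cnorm A (x \<ominus> p) + cnorm A p"
      using cnorm_add[of "x \<ominus> p" p] by simp
    ultimately show ?thesis
      using p(2) by simp
  qed
  hence "cnorm A x \<le> 0"
    by (rule field_le_epsilon)
  thus ?thesis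
    using cnorm_nonneg[OF x] cnorm_eq_0_iff[OF x] by simp
qed

end

theorem mainTheorem3:
  fixes d :: nat and \<mu> :: real
    and A :: "'a star_algebra" and a :: "nat \<Rightarrow> 'a"
    and \<pi> :: "'a \<Rightarrow> 'h \<Rightarrow> 'h :: complex_hilbert_space" and \<Omega> :: 'h
  assumes "1 \<le> d" and "- 1 < \<mu>" and "\<mu> < 1"
    and "universal_twisted_ccr_algebra d \<mu> A a"
    and "fock_representation d A a \<pi> \<Omega>"
  shows "faithful A \<pi>"
proof -
  interpret cstar_algebra A
    using assms(4) by (simp add: universal_twisted_ccr_algebra_def)
  interpret twisted_ccr_vacuum A d \<mu> a \<pi> \<Omega>
    using assms
    by unfold_locales
       (auto simp: universal_twisted_ccr_algebra_def fock_representation_def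
         irreducible_representation_def)
  show ?thesis
    unfolding faithful_def
  proof (rule inj_onI)
    fix x y assume xy: "x \<in> carrier A" "y \<in> carrier A" "\<pi> x = \<pi> y"
    have "x \<ominus>\<^bsub>A\<^esub> y = \<zero>\<^bsub>A\<^esub>"
      using xy assms(4)
      by (intro eq_zero_if_\<pi>_eq_zero) (auto simp: \<pi>_minus universal_twisted_ccr_algebra_def)
    thus "x = y"
      using xy by simp
  qed
qed

end
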